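(* Let $K$ be a link which is the closure of a braid $\boldsymbol{b}$ on $k\ge1$ strands (with its blackboard framing), let $1\le j\le k$, and let $\tilde{\boldsymbol{b}}$ denote the closure of all strands of $\boldsymbol{b}$ except the $j$-th one. Let $\mu=(0,\dots,0,1,0,\dots,0,\beta-0,\dots,\beta-0)\in\mathsf{P}^\beta_{k,k-1}$ with the $1$ in position $j$. Then: (i) for $\beta$ generic, the image of $\tilde{\boldsymbol{b}}$ in $\mathrm{End}_{\dot{\mathbf U}_q(\mathfrak{gl}_{(k)+(k-1)})_\beta}(\mathbf{1}_\mu)$ gives the reduced Homfly-Pt polynomial of $K$ (normalized to $1$ for the unknot), i.e. $\tilde{\boldsymbol{b}}=\frac{H(K)}{[\beta]}\,\mathbf{1}_\mu$; (ii) for $\beta=m$ with $m\ge2$ an integer, the image of $\tilde{\boldsymbol{b}}$ in $\mathrm{End}_{\dot{\mathbf U}_q(\mathfrak{gl}_{(k)+(k-1)})_{\beta=m}}(\mathbf{1}_\mu)$ gives the reduced $\mathfrak{sl}_m$ invariant of $K$, i.e. $\tilde{\boldsymbol{b}}=\frac{H_m(K)}{[m]}\,\mathbf{1}_\mu$.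
   Context: **Doubled Schur algebra.** $\beta$ is an integer or a formal variable ("$\beta$ generic"). The base field is $\mathbb{C}(q,q^\beta)$, equal to $\mathbb{C}(q)$ when $\beta\in\mathbb{Z}$ and a purely transcendental extension of $\mathbb{C}(q)$ by $q^\beta$ when $\beta$ is generic. Put $[x]=\frac{q^x-q^{-x}}{q-q^{-1}}$, $\mathbb{N}=\{0,1,2,\dots\}$. For $k,l\ge 0$, let $\mathsf{P}^\beta_{k,l}$ be the set of sequences $\lambda=(\lambda_1,\dots,\lambda_{k+l})$ with $\lambda_i\in\mathbb{N}$ for $i\le k$ and $\lambda_i\in\beta-\mathbb{N}$ for $i\ge k+1$. Let $\alpha_i=(0,\dots,0,1,-1,0,\dots,0)$ with $1$ in position $i$. $\dot{\mathbf U}_q(\mathfrak{gl}_{k+l})_\beta$ is the $\mathbb{C}(q,q^\beta)$-linear category with objects $\mathbf{1}_\lambda$, $\lambda\in\mathsf{P}^\beta_{k,l}$, and a zero object; morphisms are generated by the identities $\mathbf{1}_\lambda$ and by $E_i\mathbf{1}_\lambda\in\mathrm{Hom}(\mathbf{1}_\lambda,\mathbf{1}_{\lambda+\alpha_i})$, $F_i\mathbf{1}_\lambda\in\mathrm{Hom}(\mathbf{1}_\lambda,\mathbf{1}_{\lambda-\alpha_i})$, $1\le i\le k+l-1$, subject to: $\mathbf{1}_\lambda\mathbf{1}_{\lambda'}=\delta_{\lambda,\lambda'}\mathbf{1}_\lambda$; $(E_iF_j-F_jE_i)\mathbf{1}_\lambda=\delta_{i,j}[\lambda_i-\lambda_{i+1}]\mathbf{1}_\lambda$;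 $E_i^2E_j\mathbf{1}_\lambda-(q+q^{-1})E_iE_jE_i\mathbf{1}_\lambda+E_jE_i^2\mathbf{1}_\lambda=0$ and $F_i^2F_j\mathbf{1}_\lambda-(q+q^{-1})F_iF_jF_i\mathbf{1}_\lambda+F_jF_i^2\mathbf{1}_\lambda=0$ for $j=i\pm1$; $E_iE_j\mathbf{1}_\lambda=E_jE_i\mathbf{1}_\lambda$ and $F_iF_j\mathbf{1}_\lambda=F_jF_i\mathbf{1}_\lambda$ for $|i-j|>1$. Any $\mathbf{1}_\mu$ with $\mu\notin\mathsf{P}^\beta_{k,l}$ is the zero object. Products are composed right to left. **Braids.** Braids are read from bottom to top, strands oriented upward. $\sigma_i$ is the positive crossing of strands $i,i+1$ in which the strand going from bottom-left to top-right passes over; in $\sigma_i^{-1}$ the strand going from bottom-right to top-left passes over. Assign $\sigma_i\mapsto q^{-1}-E_iF_i$, $\sigma_i^{-1}\mapsto q-E_iF_i$ on weights with $\lambda_i=\lambda_{i+1}=1$, composing right to left as the braid is read bottom to top; a braid $\boldsymbol{b}$ on $k$ strands thus gives an endomorphism, also denoted $\boldsymbol{b}$, of $\mathbf{1}_{(1^k,(\beta-1)^{k-1})}$ in $\dot{\mathbf U}_q(\mathfrak{gl}_{(k)+(k-1)})_\beta$. **Closing all strands but one.** In $\dot{\mathbf U}_q(\mathfrak{gl}_{(k)+(k-1)})_\beta$, for $1\le s\le k-1$ put $D_s=F_k\,(F_{k+1}F_{k+2}\cdots F_{k+s-1})\,(F_{k-1}F_{k-2}\cdots F_{k-s+1})$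 and $D_s^*=(E_{k-s+1}\cdots E_{k-1})\,(E_{k+s-1}\cdots E_{k+1})\,E_k$ (empty products are identities). Then $D_{k-1}\cdots D_1:\mathbf{1}_{(1^k,(\beta-1)^{k-1})}\to\mathbf{1}_{(1,0^{k-1},\beta^{k-1})}$ caps off strands $2,\dots,k$ to the right, and $D_1^*\cdots D_{k-1}^*$ is the corresponding system of cups. If the open strand is the first ($j=1$), $\tilde{\boldsymbol{b}}=D_{k-1}\cdots D_1\,\boldsymbol{b}\,D_1^*\cdots D_{k-1}^*$. For general $j$, the arcs closing the strands to the left of the open strand pass over it: with the braid $c=\sigma_{j-1}^{-1}\cdots\sigma_2^{-1}\sigma_1^{-1}$ (product read right to left, moving strand $1$ to position $j$ under the others), $\tilde{\boldsymbol{b}}=(F_{j-1}\cdots F_2F_1)\,D_{k-1}\cdots D_1\,c^{-1}\boldsymbol{b}\,c\,D_1^*\cdots D_{k-1}^*\,(E_1E_2\cdots E_{j-1})\in\mathrm{End}(\mathbf{1}_\mu)$. **Link polynomials.** The framed Homfly-Pt polynomial $H$ (with $\beta$ generic) is the invariant of oriented framed links with values in $\mathbb{C}(q,q^\beta)$ determined by: $H(L_+)-H(L_-)=(q^{-1}-q)H(L_0)$ for blackboard-framed diagrams differing only near one crossing, which is positive in $L_+$, negative in $L_-$, and replaced by its oriented smoothing in $L_0$; a diagram with an added positive (resp. negative) kink has value $q^{-\beta}$ (resp. $q^{\beta}$) times the value of the diagram without it; and $H=[\beta]$ on the $0$-framed unknot. The framed $\mathfrak{sl}_m$ invariant $H_m$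 is given by the same rules with $q^\beta$ replaced by $q^m$. The reduced versions are obtained by dividing by the value of the unknot. *)

theory Defs
  imports
    "HOL-Computational_Algebra.Polynomial"
    "HOL-Computational_Algebra.Fraction_Field"
    "HOL-Library.Poly_Mapping"
begin

section \<open>Base fields and quantum integers\<close>

text \<open>
  All notions depend on a pair \<open>(qe, \<beta>)\<close>: an element \<open>\<beta>\<close> of a ring \<open>'w\<close> containing the
  possible entries of weights, and an exponential \<open>qe x = q^x\<close> with values in the base field \<open>'f\<close>.
  Two pairs are used:
  for generic \<open>\<beta>\<close>, \<open>'w\<close> is \<open>\<int>[\<beta>]\<close> (the type \<open>int poly\<close>, with \<open>\<beta> = [:0, 1:]\<close>),
  of which only the elements \<open>a + b \<beta>\<close> ever occur as exponents, and \<open>'f\<close> is the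
  field of fractions of \<open>\<complex>[q][q^\<beta>]\<close>;
  for an integer \<open>\<beta> = m\<close>, \<open>'w\<close> is \<open>int\<close> and \<open>'f\<close> is \<open>\<complex>(q)\<close>.
\<close>

definition qexp_gen :: "int poly \<Rightarrow> complex poly poly fract" where
  "qexp_gen x = (Fract [:[:0, 1:]:] 1) powi (coeff x 0) * (Fract [:0, 1:] 1) powi (coeff x 1)"

definition beta_gen :: "int poly" where
  "beta_gen = [:0, 1:]"

definition qexp_int :: "int \<Rightarrow> complex poly fract" where
  "qexp_int n = (Fract [:0, 1:] 1) powi n"

definition qint :: "('w::ring_1 \<Rightarrow> 'f::field) \<Rightarrow> 'w \<Rightarrow> 'f" where
  "qint qe x = (qe x - qe (- x)) / (qe 1 - qe (- 1))"


section \<open>The doubled Schur algebra\<close>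

text \<open>Sequences are 1-based functions on \<open>nat\<close>, extended by 0 outside of \<open>{1..k + l}\<close>.\<close>

type_synonym 'w weight = "nat \<Rightarrow> 'w"

definition weights :: "'w::ring_1 \<Rightarrow> nat \<Rightarrow> nat \<Rightarrow> 'w weight set" where
  "weights \<beta> k l = {\<nu>. (\<forall>i\<in>{1..k}. \<nu> i \<in> \<nat>) \<and> (\<forall>i\<in>{k+1..k+l}. \<beta> - \<nu> i \<in> \<nat>)
                      \<and> (\<forall>i. i \<notin> {1..k+l} \<longrightarrow> \<nu> i = 0)}"

definition alpha :: "nat \<Rightarrow> 'w::ring_1 weight" where
  "alpha i = (\<lambda>t. if t = i then 1 else if t = i + 1 then - 1 else 0)"

datatype gen = GenE nat | GenF nat

primrec gen_index :: "gen \<Rightarrow> nat" where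
  "gen_index (GenE i) = i"
| "gen_index (GenF i) = i"

primrec shift :: "gen \<Rightarrow> 'w::ring_1 weight \<Rightarrow> 'w weight" where
  "shift (GenE i) \<nu> = (\<lambda>t. \<nu> t + alpha i t)"
| "shift (GenF i) \<nu> = (\<lambda>t. \<nu> t - alpha i t)"

text \<open>
  Words form the free monoid on the generators; the finitely supported functions on words,
  with convolution product, form the free associative algebra. The product \<open>x * y\<close> stands
  for the composite ``first \<open>y\<close>, then \<open>x\<close>''. An element \<open>x\<close> of the algebra, considered
  at a weight \<open>\<nu>\<close>, represents the morphism \<open>x 1\<^sub>\<nu>\<close>.
\<close>

datatype word = Word (letters: "gen list")

instantiation word :: monoid_add
begin

definition zero_word :: word where
  "zero_word = Word []"

definition plus_word :: "word \<Rightarrow> word \<Rightarrow> word" where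
  "plus_word u v = Word (letters u @ letters v)"

instance
  by standard (simp_all add: zero_word_def plus_word_def)

end

type_synonym 'f free_alg = "word \<Rightarrow>\<^sub>0 'f"

definition word_elt :: "word \<Rightarrow> 'f::field free_alg" where
  "word_elt w = Poly_Mapping.single w 1"

definition scal :: "'f::field \<Rightarrow> 'f free_alg" where
  "scal c = Poly_Mapping.single 0 c"

definition EE :: "nat \<Rightarrow> 'f::field free_alg" where
  "EE i = word_elt (Word [GenE i])"

definition FF :: "nat \<Rightarrow> 'f::field free_alg" where
  "FF i = word_elt (Word [GenF i])"

definition admissible :: "nat \<Rightarrow> nat \<Rightarrow> word \<Rightarrow> bool" where
  "admissible k l w \<longleftrightarrow> (\<forall>g\<in>set (letters w). 1 \<le> gen_index g \<and> gen_index g + 1 \<le> k + l)"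

definition target :: "word \<Rightarrow> 'w::ring_1 weight \<Rightarrow> 'w weight" where
  "target w \<nu> = foldr shift (letters w) \<nu>"

inductive_set relators ::
  "('w::ring_1 \<Rightarrow> 'f::field) \<Rightarrow> nat \<Rightarrow> nat \<Rightarrow> 'w weight \<Rightarrow> 'f free_alg set"
  for qe :: "'w \<Rightarrow> 'f" and k l :: nat and \<nu> :: "'w weight"
where
  commutator: "i \<in> {1..<k+l} \<Longrightarrow> j \<in> {1..<k+l} \<Longrightarrow>
    EE i * FF j - FF j * EE i - (if i = j then scal (qint qe (\<nu> i - \<nu> (i + 1))) else 0)
      \<in> relators qe k l \<nu>"
| serre_E: "i \<in> {1..<k+l} \<Longrightarrow> j \<in> {1..<k+l} \<Longrightarrow> j = i + 1 \<or> i = j + 1 \<Longrightarrow>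
    EE i * EE i * EE j - scal (qe 1 + qe (- 1)) * EE i * EE j * EE i + EE j * EE i * EE i
      \<in> relators qe k l \<nu>"
| serre_F: "i \<in> {1..<k+l} \<Longrightarrow> j \<in> {1..<k+l} \<Longrightarrow> j = i + 1 \<or> i = j + 1 \<Longrightarrow>
    FF i * FF i * FF j - scal (qe 1 + qe (- 1)) * FF i * FF j * FF i + FF j * FF i * FF i
      \<in> relators qe k l \<nu>"
| far_E: "i \<in> {1..<k+l} \<Longrightarrow> j \<in> {1..<k+l} \<Longrightarrow> i + 1 < j \<or> j + 1 < i \<Longrightarrow>
    EE i * EE j - EE j * EE i \<in> relators qe k l \<nu>"
| far_F: "i \<in> {1..<k+l} \<Longrightarrow> j \<in> {1..<k+l} \<Longrightarrow> i + 1 < j \<or> j + 1 < i \<Longrightarrow>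
    FF i * FF j - FF j * FF i \<in> relators qe k l \<nu>"

text \<open>
  \<open>null qe \<beta> k l \<nu>\<close> consists of the \<open>x\<close> with \<open>x 1\<^sub>\<nu> = 0\<close>: it is the linear span of the
  composites containing a defining relator at the weight where it is applied (\<open>relator\<close>) and of
  the words passing through a weight outside of \<open>weights \<beta> k l\<close>, i.e. through the zero
  object (\<open>zero_object\<close>).
\<close>

inductive_set null ::
  "('w::ring_1 \<Rightarrow> 'f::field) \<Rightarrow> 'w \<Rightarrow> nat \<Rightarrow> nat \<Rightarrow> 'w weight \<Rightarrow> 'f free_alg set"
  for qe :: "'w \<Rightarrow> 'f" and \<beta> :: 'w and k l :: nat and \<nu> :: "'w weight"
where
  zero: "0 \<in> null qe \<beta> k l \<nu>"
| add: "x \<in> null qe \<beta> k l \<nu> \<Longrightarrow> y \<in> null qe \<beta> k l \<nu> \<Longrightarrow> x + y \<in> null qe \<beta> k l \<nu>"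
| scale: "x \<in> null qe \<beta> k l \<nu> \<Longrightarrow> scal c * x \<in> null qe \<beta> k l \<nu>"
| relator: "admissible k l u \<Longrightarrow> admissible k l v \<Longrightarrow> r \<in> relators qe k l (target v \<nu>) \<Longrightarrow>
    word_elt u * r * word_elt v \<in> null qe \<beta> k l \<nu>"
| zero_object: "admissible k l u \<Longrightarrow> admissible k l v \<Longrightarrow> target v \<nu> \<notin> weights \<beta> k l \<Longrightarrow>
    word_elt u * word_elt v \<in> null qe \<beta> k l \<nu>"

text \<open>
  \<open>Hom(1\<^sub>\<nu>, 1\<^sub>\<mu>)\<close> is the quotient of the space spanned by the admissible words leading from \<open>\<nu>\<close>
  to \<open>\<mu>\<close> (\<open>hom_rep\<close>). The class \<open>mor qe \<beta> k l \<nu> \<mu> x\<close> is empty, hence not a morphism, if \<open>x\<close> is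
  not in \<open>hom_rep k l \<nu> \<mu>\<close>.
\<close>

definition hom_rep :: "nat \<Rightarrow> nat \<Rightarrow> 'w::ring_1 weight \<Rightarrow> 'w weight \<Rightarrow> 'f::field free_alg set" where
  "hom_rep k l \<nu> \<mu> = {x. \<forall>w\<in>Poly_Mapping.keys x. admissible k l w \<and> target w \<nu> = \<mu>}"

definition hom_rel :: "('w::ring_1 \<Rightarrow> 'f::field) \<Rightarrow> 'w \<Rightarrow> nat \<Rightarrow> nat \<Rightarrow>
    'w weight \<Rightarrow> 'w weight \<Rightarrow> ('f free_alg \<times> 'f free_alg) set" where
  "hom_rel qe \<beta> k l \<nu> \<mu> =
     {(x, y). x \<in> hom_rep k l \<nu> \<mu> \<and> y \<in> hom_rep k l \<nu> \<mu> \<and> x - y \<in> null qe \<beta> k l \<nu>}"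

definition Hom :: "('w::ring_1 \<Rightarrow> 'f::field) \<Rightarrow> 'w \<Rightarrow> nat \<Rightarrow> nat \<Rightarrow>
    'w weight \<Rightarrow> 'w weight \<Rightarrow> 'f free_alg set set" where
  "Hom qe \<beta> k l \<nu> \<mu> = hom_rep k l \<nu> \<mu> // hom_rel qe \<beta> k l \<nu> \<mu>"

definition mor :: "('w::ring_1 \<Rightarrow> 'f::field) \<Rightarrow> 'w \<Rightarrow> nat \<Rightarrow> nat \<Rightarrow>
    'w weight \<Rightarrow> 'w weight \<Rightarrow> 'f free_alg \<Rightarrow> 'f free_alg set" where
  "mor qe \<beta> k l \<nu> \<mu> x = hom_rel qe \<beta> k l \<nu> \<mu> `` {x}"


section \<open>Braids and the partial closure\<close>

text \<open>
  A braid is given by a word in the Artin generators, listed from bottom to top;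
  \<open>(i, True)\<close> is \<open>\<sigma>\<^sub>i\<close> and \<open>(i, False)\<close> its inverse. As a product, the same braid is read from
  right to left.
\<close>

type_synonym braid = "(nat \<times> bool) list"

definition braid_word :: "nat \<Rightarrow> braid \<Rightarrow> bool" where
  "braid_word k b \<longleftrightarrow> (\<forall>(i, p)\<in>set b. 1 \<le> i \<and> i < k)"

definition crossing :: "('w::ring_1 \<Rightarrow> 'f::field) \<Rightarrow> nat \<times> bool \<Rightarrow> 'f free_alg" where
  "crossing qe = (\<lambda>(i, p). scal (if p then qe (- 1) else qe 1) - EE i * FF i)"

definition braid_elt :: "('w::ring_1 \<Rightarrow> 'f::field) \<Rightarrow> braid \<Rightarrow> 'f free_alg" where
  "braid_elt qe b = prod_list (map (crossing qe) (rev b))"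

definition inv_braid :: "braid \<Rightarrow> braid" where
  "inv_braid b = rev (map (\<lambda>(i, p). (i, \<not> p)) b)"

definition pass_under :: "nat \<Rightarrow> braid" where
  "pass_under j = map (\<lambda>i. (i, False)) [1..<j]"

definition DD :: "nat \<Rightarrow> nat \<Rightarrow> 'f::field free_alg" where
  "DD k s = FF k * prod_list (map FF [k+1..<k+s]) * prod_list (map FF (rev [k-s+1..<k]))"

definition DDs :: "nat \<Rightarrow> nat \<Rightarrow> 'f::field free_alg" where
  "DDs k s = prod_list (map EE [k-s+1..<k]) * prod_list (map EE (rev [k+1..<k+s])) * EE k"

definition partial_closure ::
  "('w::ring_1 \<Rightarrow> 'f::field) \<Rightarrow> nat \<Rightarrow> nat \<Rightarrow> braid \<Rightarrow> 'f free_alg" where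
  "partial_closure qe k j b =
     prod_list (map FF (rev [1..<j])) * prod_list (map (DD k) (rev [1..<k]))
     * braid_elt qe (inv_braid (pass_under j)) * braid_elt qe b * braid_elt qe (pass_under j)
     * prod_list (map (DDs k) [1..<k]) * prod_list (map EE [1..<j])"

definition mu :: "'w::ring_1 \<Rightarrow> nat \<Rightarrow> nat \<Rightarrow> 'w weight" where
  "mu \<beta> k j = (\<lambda>i. if i = j then 1 else if k + 1 \<le> i \<and> i \<le> k + (k - 1) then \<beta> else 0)"


section \<open>Oriented framed link diagrams and the Homfly-Pt polynomial\<close>

text \<open>
  Oriented planar diagrams, in general position with respect to the height function, are cut
  into horizontal layers and listed from bottom to top. A layer \<open>(i, P)\<close> has one elementary
  piece \<open>P\<close> with \<open>i\<close> vertical strands to its left: a cup (local minimum, the flag tells whether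
  its left leg is oriented upward), a cap (local maximum), or a crossing (the flag tells
  whether the line from bottom left to top right is the overpass, regardless of orientations).
  The points of the diagram on a horizontal line are recorded from left to right by a list of
  orientations, \<open>True\<close> meaning upward.
\<close>

datatype piece = Cup bool | Cap | Cross bool

type_synonym diagram = "(nat \<times> piece) list"

inductive layer :: "nat \<times> piece \<Rightarrow> bool list \<Rightarrow> bool list \<Rightarrow> bool" where
  cup: "layer (length s, Cup u) (s @ t) (s @ [u, \<not> u] @ t)"
| cap: "layer (length s, Cap) (s @ [u, \<not> u] @ t) (s @ t)"
| cross: "layer (length s, Cross c) (s @ [u, v] @ t) (s @ [v, u] @ t)"

inductive tangle :: "diagram \<Rightarrow> bool list \<Rightarrow> bool list \<Rightarrow> bool" where
  Nil: "tangle [] s s"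
| Cons: "layer x s t \<Longrightarrow> tangle d t r \<Longrightarrow> tangle (x # d) s r"

definition link_diagram :: "diagram \<Rightarrow> bool" where
  "link_diagram d \<longleftrightarrow> tangle d [] []"

primrec inputs :: "piece \<Rightarrow> nat" where
  "inputs (Cup u) = 0" | "inputs Cap = 2" | "inputs (Cross c) = 2"

primrec outputs :: "piece \<Rightarrow> nat" where
  "outputs (Cup u) = 2" | "outputs Cap = 0" | "outputs (Cross c) = 2"

text \<open>
  Local moves generating regular isotopy: planar isotopy (\<open>far\<close>: exchanging the heights of two
  distant pieces; \<open>zigzag\<close>: cancelling a maximum against a minimum; \<open>swing\<close>: moving a strand
  crossing one leg of a cap or cup to the other leg) and the second and third Reidemeister moves.
\<close>

inductive local_move :: "diagram \<Rightarrow> diagram \<Rightarrow> bool" where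
  far: "local_move [(i, P), (i + outputs P + n, Q)] [(i + inputs P + n, Q), (i, P)]"
| zigzag1: "local_move [(i, Cup u), (i + 1, Cap)] []"
| zigzag2: "local_move [(i + 1, Cup u), (i, Cap)] []"
| swing_cap: "local_move [(i + 1, Cross c), (i, Cap)] [(i, Cross (\<not> c)), (i + 1, Cap)]"
| swing_cup: "local_move [(i, Cup u), (i + 1, Cross c)] [(i + 1, Cup u), (i, Cross (\<not> c))]"
| reidemeister2: "local_move [(i, Cross c), (i, Cross (\<not> c))] []"
| reidemeister3: "local_move [(i, Cross c), (i + 1, Cross c), (i, Cross c)]
                             [(i + 1, Cross c), (i, Cross c), (i + 1, Cross c)]"

text \<open>
  \<open>framed_homfly qe \<beta> H\<close> states that \<open>H\<close>, as a function of blackboard-framed diagrams, is the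
  framed Homfly-Pt polynomial with parameters \<open>q = qe 1\<close> and \<open>q^\<beta> = qe \<beta>\<close>. Invariance of \<open>H\<close>
  under regular isotopy together with the kink rule is invariance under isotopy of framed links.
  The rules have a solution (the classical existence theorem, not needed here) which is unique
  on nonempty diagrams; they do not constrain the value at the empty diagram.

  A crossing \<open>Cross c\<close> between parallel strands (both upward or both downward) is positive iff
  \<open>c\<close>, and its oriented smoothing consists of two vertical strands; if the strands are
  antiparallel, it is positive iff \<open>\<not> c\<close>, and its oriented smoothing is a cap followed by a cup.
  The crossing in a kink is one between parallel strands.
\<close>

definition framed_homfly ::
  "('w::ring_1 \<Rightarrow> 'f::field) \<Rightarrow> 'w \<Rightarrow> (diagram \<Rightarrow> 'f) \<Rightarrow> bool" where
  "framed_homfly qe \<beta> H \<longleftrightarrow>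
    \<comment> \<open>regular isotopy\<close>
    (\<forall>A X Y B. local_move X Y \<and> link_diagram (A @ X @ B) \<and> link_diagram (A @ Y @ B)
        \<longrightarrow> H (A @ X @ B) = H (A @ Y @ B)) \<and>
    \<comment> \<open>skein relation, parallel strands\<close>
    (\<forall>A B s t u. tangle A [] (s @ [u, u] @ t) \<and> tangle B (s @ [u, u] @ t) []
        \<longrightarrow> H (A @ [(length s, Cross True)] @ B) - H (A @ [(length s, Cross False)] @ B)
            = (qe (- 1) - qe 1) * H (A @ B)) \<and>
    \<comment> \<open>skein relation, antiparallel strands\<close>
    (\<forall>A B s t u. tangle A [] (s @ [u, \<not> u] @ t) \<and> tangle B (s @ [\<not> u, u] @ t) []
        \<longrightarrow> H (A @ [(length s, Cross False)] @ B) - H (A @ [(length s, Cross True)] @ B)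
            = (qe (- 1) - qe 1) * H (A @ [(length s, Cap), (length s, Cup (\<not> u))] @ B)) \<and>
    \<comment> \<open>kinks to the right and to the left of a strand\<close>
    (\<forall>A B i u c. link_diagram (A @ [(i + 1, Cup u), (i, Cross c), (i + 1, Cap)] @ B)
        \<longrightarrow> H (A @ [(i + 1, Cup u), (i, Cross c), (i + 1, Cap)] @ B)
            = (if c then qe (- \<beta>) else qe \<beta>) * H (A @ B)) \<and>
    (\<forall>A B i u c. link_diagram (A @ [(i, Cup u), (i + 1, Cross c), (i, Cap)] @ B)
        \<longrightarrow> H (A @ [(i, Cup u), (i + 1, Cross c), (i, Cap)] @ B)
            = (if c then qe (- \<beta>) else qe \<beta>) * H (A @ B)) \<and>
    \<comment> \<open>the 0-framed unknot, in either orientation\<close>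
    (\<forall>u. H [(0, Cup u), (0, Cap)] = qint qe \<beta>)"

text \<open>The closing strands run to the right of the braid.\<close>

definition braid_closure :: "nat \<Rightarrow> braid \<Rightarrow> diagram" where
  "braid_closure k b =
     map (\<lambda>i. (i, Cup True)) [0..<k] @ map (\<lambda>(i, p). (i - 1, Cross p)) b
     @ map (\<lambda>i. (i, Cap)) (rev [0..<k])"

end

theory Submission
  imports Defs
begin

text \<open>
  Both sides are Markov traces on the Hecke algebra. On weights with all relevant entries 1 the
  endomorphisms \<open>U\<^sub>i = E\<^sub>iF\<^sub>i\<close> satisfy the Hecke relations \<open>U\<^sub>i\<^sup>2 = [2] U\<^sub>i\<close> and
  \<open>U\<^sub>iU\<^sub>jU\<^sub>i - U\<^sub>i = U\<^sub>jU\<^sub>iU\<^sub>j - U\<^sub>j\<close> for \<open>j = i + 1\<close>, both sides being \<open>F\<^sub>jU\<^sub>iE\<^sub>j\<close>.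
  Capping off the last strand by \<open>D\<^sub>s\<close> and \<open>D\<^sub>s\<^sup>*\<close> sends a braid on the remaining
  strands to \<open>[\<beta>]\<close> times itself and replaces the last crossing by \<open>q\<^sup>-\<^sup>\<beta>\<close>: the ladder
  \<open>D\<^sub>sD\<^sub>s\<^sup>*\<close> is \<open>[\<beta>]\<close> at \<open>(0, \<dots>, 0 | \<beta>, \<dots>, \<beta>)\<close>, is \<open>[\<beta> - 1]\<close> at \<open>(1, 0, \<dots>, 0 | \<beta>, \<dots>, \<beta>)\<close>, and
  \<open>q\<^sup>-\<^sup>1[\<beta>] - [\<beta> - 1] = q\<^sup>-\<^sup>\<beta>\<close>. The polynomial \<open>H\<close> obeys the same two rules by the kink relation and
  the skein relation. Every braid word on \<open>n + 1\<close> strands reduces by skein and braid relations to words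
  containing \<open>\<sigma>\<^sub>n\<close> at most once, so the two traces agree up to normalization. The case of a general \<open>j\<close>
  reduces to \<open>j = 1\<close> because \<open>H\<close> does not change under conjugation of the braid: a crossing slides
  around the closing arcs.
\<close>

section \<open>Words and central scalars\<close>

section \<open>The free algebra\<close>

lemma word_elt_mult: "word_elt u * word_elt v = word_elt (u + v)"
  by (simp add: word_elt_def mult_single)

lemma word_elt_zero [simp]: "word_elt 0 = 1"
  by (simp add: word_elt_def)

lemma letters_plus [simp]: "letters (u + v) = letters u @ letters v"
  by (simp add: plus_word_def)

lemma letters_zero [simp]: "letters 0 = []"
  by (simp add: zero_word_def)

lemma scal_mult: "scal a * scal b = scal (a * b)"
  by (simp add: scal_def mult_single)

lemma scal_add: "scal a + scal b = scal (a + b)"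
  by (simp add: scal_def single_add)

lemma scal_diff: "scal a - scal b = scal (a - b)"
  by (simp add: scal_def single_diff)

lemma scal_1 [simp]: "scal 1 = 1"
  by (simp add: scal_def)

lemma scal_0 [simp]: "scal 0 = 0"
  by (simp add: scal_def)

lemma scal_minus: "scal (- a) = - scal a"
  by (simp add: scal_def single_uminus)

lemma scal_word_elt: "scal c * word_elt w = Poly_Mapping.single w c"
  by (simp add: scal_def word_elt_def mult_single)

text \<open>Expansion in the basis of words; rewriting with it reduces statements linear in
  \<open>x\<close> to single words.\<close>

lemma free_alg_sum: "x = (\<Sum>w\<in>Poly_Mapping.keys x. scal (Poly_Mapping.lookup x w) * word_elt w)"
proof (rule poly_mapping_eqI)
  fix w
  have "Poly_Mapping.lookup (\<Sum>w\<in>Poly_Mapping.keys x. scal (Poly_Mapping.lookup x w) * word_elt w) w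
      = (\<Sum>v\<in>Poly_Mapping.keys x. if v = w then Poly_Mapping.lookup x v else 0)"
    by (simp add: scal_word_elt lookup_sum lookup_single when_def)
  also have "\<dots> = Poly_Mapping.lookup x w"
    by (simp add: in_keys_iff)
  finally show "Poly_Mapping.lookup x w = Poly_Mapping.lookup (\<Sum>w\<in>Poly_Mapping.keys x. scal (Poly_Mapping.lookup x w) * word_elt w) w"
    by simp
qed

text \<open>A scalar sits at the empty word, which is neutral for concatenation, so it commutes with
  every word; linearity does the rest.\<close>

lemma scal_central: "x * scal c = scal c * (x :: 'f::field free_alg)"
proof -
  have "word_elt w * scal c = scal c * (word_elt w :: 'f free_alg)" for w
    by (simp add: scal_def word_elt_def mult_single)
  then have "(\<Sum>w\<in>Poly_Mapping.keys x. scal (Poly_Mapping.lookup x w) * word_elt w) * scal c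
      = scal c * (\<Sum>w\<in>Poly_Mapping.keys x. scal (Poly_Mapping.lookup x w) * word_elt w)"
    by (simp add: sum_distrib_left sum_distrib_right mult.assoc)
       (simp add: scal_mult mult.commute flip: mult.assoc)
  then show ?thesis
    by (simp flip: free_alg_sum)
qed

lemma prod_list_FF: "prod_list (map FF xs) = word_elt (Word (map GenF xs))"
  by (induction xs) (simp_all add: FF_def word_elt_mult plus_word_def flip: zero_word_def)

lemma prod_list_EE: "prod_list (map EE xs) = word_elt (Word (map GenE xs))"
  by (induction xs) (simp_all add: EE_def word_elt_mult plus_word_def flip: zero_word_def)

section \<open>Weights reached by words\<close>

lemma target_plus: "target (u + v) \<nu> = target u (target v \<nu>)"
  by (simp add: target_def)

lemma target_zero [simp]: "target 0 \<nu> = \<nu>"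
  by (simp add: target_def)

primrec weight_of :: "gen \<Rightarrow> 'w::ring_1 weight" where
  "weight_of (GenE i) = alpha i"
| "weight_of (GenF i) = (\<lambda>t. - alpha i t)"

text \<open>Each letter adds a fixed vector, so the end weight does not depend on the order of the
  letters. Hence a chain and its reversal have the same target.\<close>

lemma target_Word: "target (Word gs) \<nu> = (\<lambda>t. \<nu> t + (\<Sum>g\<leftarrow>gs. weight_of g t))"
proof (induction gs)
  case Nil
  then show ?case by (simp add: target_def)
next
  case (Cons g gs)
  then show ?case
    by (cases g) (auto simp: target_def fun_eq_iff algebra_simps)
qed

text \<open>The roots telescope: what \<open>alpha i\<close> takes from entry \<open>i + 1\<close>
  is restored by \<open>alpha (i + 1)\<close>.\<close>

lemma sum_list_alpha: "a \<le> c \<Longrightarrow>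
  (\<Sum>i\<leftarrow>[a..<c]. alpha i t :: 'w::ring_1) = (if t = a then 1 else 0) - (if t = c then 1 else 0)"
proof (induction c rule: dec_induct)
  case base
  then show ?case by simp
next
  case (step n)
  then show ?case by (simp add: alpha_def)
qed

text \<open>One unit moves from entry \<open>c\<close> to entry \<open>a\<close>. For
  \<open>a \<le> c\<close> this is the effect of the \<open>EE\<close> letters with indices from
  \<open>a\<close> to \<open>c - 1\<close>; exchanging the arguments gives that of the
  \<open>FF\<close> letters.\<close>

definition transfer :: "nat \<Rightarrow> nat \<Rightarrow> 'w::ring_1 weight \<Rightarrow> 'w weight" where
  "transfer a c \<nu> = (\<lambda>t. \<nu> t + (if t = a then 1 else 0) - (if t = c then 1 else 0))"

lemma transfer_self [simp]: "transfer a a \<nu> = \<nu>"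
  by (simp add: transfer_def)

lemma shift_transfer: "shift (GenE i) \<nu> = transfer i (i + 1) \<nu>" "shift (GenF i) \<nu> = transfer (i + 1) i \<nu>"
  by (auto simp: transfer_def alpha_def fun_eq_iff)

lemma target_EE_chain: "a \<le> c \<Longrightarrow> target (Word (map GenE [a..<c])) \<nu> = transfer a c \<nu>"
  by (simp add: target_Word comp_def sum_list_alpha transfer_def algebra_simps)

lemma target_EE_chain_rev: "a \<le> c \<Longrightarrow> target (Word (map GenE (rev [a..<c]))) \<nu> = transfer a c \<nu>"
  by (simp add: target_Word comp_def sum_list_alpha transfer_def algebra_simps rev_map[symmetric] sum_list_rev)

lemma sum_list_neg_alpha: "(\<Sum>i\<leftarrow>xs. - alpha i t :: 'w::ring_1) = - (\<Sum>i\<leftarrow>xs. alpha i t)"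
  by (induction xs) auto

lemma target_FF_chain: "a \<le> c \<Longrightarrow> target (Word (map GenF [a..<c])) \<nu> = transfer c a \<nu>"
  by (simp add: target_Word comp_def sum_list_neg_alpha sum_list_alpha transfer_def algebra_simps)

lemma target_FF_chain_rev: "a \<le> c \<Longrightarrow> target (Word (map GenF (rev [a..<c]))) \<nu> = transfer c a \<nu>"
  by (simp add: target_Word comp_def sum_list_neg_alpha sum_list_alpha transfer_def algebra_simps rev_map[symmetric] sum_list_rev)


section \<open>Congruence modulo the relations\<close>

text \<open>Common setting for generic and integer \<open>\<beta>\<close>. The last assumption keeps
  an entry \<open>- 1\<close> in the first half and \<open>\<beta> + 1\<close> in the second half
  outside of \<open>weights\<close>; all vanishing results rest on this.\<close>

locale doubled_schur =
  fixes qe :: "'w::ring_1 \<Rightarrow> 'f::field" and \<beta> :: 'w and k l :: nat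
  assumes qe_0: "qe 0 = 1"
    and qe_add: "qe (x + y) = qe x * qe y"
    and q_neq: "qe 1 \<noteq> qe (- 1)"
    and neg_one_notin_Nats: "(- 1 :: 'w) \<notin> \<nat>"
begin

text \<open>Equality of the morphisms that \<open>x\<close> and \<open>y\<close> represent at the
  start weight \<open>\<nu>\<close>.\<close>

definition eqv :: "'f free_alg \<Rightarrow> 'w weight \<Rightarrow> 'f free_alg \<Rightarrow> bool"
    ("(_/ \<approx>\<^bsub>_\<^esub>/ _)" [51, 0, 51] 50) where
  "x \<approx>\<^bsub>\<nu>\<^esub> y \<longleftrightarrow> x - y \<in> null qe \<beta> k l \<nu>"

lemma null_uminus: "x \<in> null qe \<beta> k l \<nu> \<Longrightarrow> - x \<in> null qe \<beta> k l \<nu>"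
  using null.scale[of x qe \<beta> k l \<nu> "- 1"] by (simp add: scal_minus)

lemma eqv_refl [simp, intro]: "x \<approx>\<^bsub>\<nu>\<^esub> x"
  by (simp add: eqv_def null.zero)

lemma eqv_sym: "x \<approx>\<^bsub>\<nu>\<^esub> y \<Longrightarrow> y \<approx>\<^bsub>\<nu>\<^esub> x"
  using null_uminus[of "x - y"] by (simp add: eqv_def)

lemma eqv_trans [trans]: "x \<approx>\<^bsub>\<nu>\<^esub> y \<Longrightarrow> y \<approx>\<^bsub>\<nu>\<^esub> z \<Longrightarrow> x \<approx>\<^bsub>\<nu>\<^esub> z"
  using null.add[of "x - y" qe \<beta> k l \<nu> "y - z"] by (simp add: eqv_def)

lemma eqv_add: "x \<approx>\<^bsub>\<nu>\<^esub> y \<Longrightarrow> x' \<approx>\<^bsub>\<nu>\<^esub> y' \<Longrightarrow> x + x' \<approx>\<^bsub>\<nu>\<^esub> y + y'"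
  using null.add[of "x - y" qe \<beta> k l \<nu> "x' - y'"] by (simp add: eqv_def algebra_simps)

lemma eqv_diff: "x \<approx>\<^bsub>\<nu>\<^esub> y \<Longrightarrow> x' \<approx>\<^bsub>\<nu>\<^esub> y' \<Longrightarrow> x - x' \<approx>\<^bsub>\<nu>\<^esub> y - y'"
  using null.add[OF _ null_uminus, of "x - y" \<nu> "x' - y'"] by (simp add: eqv_def algebra_simps)

lemma eqv_scal: "x \<approx>\<^bsub>\<nu>\<^esub> y \<Longrightarrow> scal c * x \<approx>\<^bsub>\<nu>\<^esub> scal c * y"
  using null.scale[of "x - y" qe \<beta> k l \<nu> c] by (simp add: eqv_def algebra_simps)

lemma null_sum: "(\<And>i. i \<in> I \<Longrightarrow> f i \<in> null qe \<beta> k l \<nu>) \<Longrightarrow> sum f I \<in> null qe \<beta> k l \<nu>"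
  by (induction I rule: infinite_finite_induct) (auto intro: null.intros)

lemma admissible_plus: "admissible k l (u + v) \<longleftrightarrow> admissible k l u \<and> admissible k l v"
  by (auto simp: admissible_def)

text \<open>The spanning elements begin with an arbitrary word, which absorbs \<open>w\<close>; the
  weight at which a relator is applied stays the same.\<close>

lemma null_word_mult:
  assumes "x \<in> null qe \<beta> k l \<nu>" and "admissible k l w"
  shows "word_elt w * x \<in> null qe \<beta> k l \<nu>"
  using assms(1)
proof induction
  case (add x y)
  then show ?case by (simp add: distrib_left null.add)
next
  case (scale x c)
  then show ?case
    by (metis mult.assoc null.scale scal_central)
next
  case (relator u v r)
  then show ?case
    using null.relator[of k l "w + u" v r qe \<nu> \<beta>] assms(2)
    by (simp add: admissible_plus flip: word_elt_mult mult.assoc)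
next
  case (zero_object u v)
  then show ?case
    using null.zero_object[of k l "w + u" v \<nu> \<beta> qe] assms(2)
    by (simp add: admissible_plus flip: word_elt_mult mult.assoc)
qed (simp add: null.zero)

text \<open>Now \<open>w\<close> acts first, so the other factor has to vanish at the weight to
  which \<open>w\<close> leads.\<close>

lemma null_mult_word:
  assumes "x \<in> null qe \<beta> k l (target w \<nu>)" and "admissible k l w"
  shows "x * word_elt w \<in> null qe \<beta> k l \<nu>"
  using assms(1)
proof induction
  case (add x y)
  then show ?case by (simp add: distrib_right null.add)
next
  case (scale x c)
  then show ?case
    by (simp add: mult.assoc null.scale)
next
  case (relator u v r)
  then show ?case
    using null.relator[of k l u "v + w" r qe \<nu> \<beta>] assms(2)
    by (simp add: admissible_plus target_plus mult.assoc flip: word_elt_mult)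
next
  case (zero_object u v)
  then show ?case
    using null.zero_object[of k l u "v + w" \<nu> \<beta> qe] assms(2)
    by (simp add: admissible_plus target_plus mult.assoc flip: word_elt_mult)
qed (simp add: null.zero)

lemma eqv_mult_hom_left:
  assumes "x \<approx>\<^bsub>\<nu>\<^esub> y" and "z \<in> hom_rep k l \<nu>' \<mu>"
  shows "z * x \<approx>\<^bsub>\<nu>\<^esub> z * y"
proof -
  have "(\<Sum>w\<in>Poly_Mapping.keys z. scal (Poly_Mapping.lookup z w) * word_elt w) * (x - y) \<in> null qe \<beta> k l \<nu>"
    unfolding sum_distrib_right mult.assoc using assms
    by (intro null_sum null.scale null_word_mult) (auto simp: eqv_def hom_rep_def)
  then show ?thesis
    by (simp add: eqv_def right_diff_distrib flip: free_alg_sum)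
qed

lemma eqv_mult_right:
  assumes "x \<approx>\<^bsub>\<mu>\<^esub> y" and "z \<in> hom_rep k l \<nu> \<mu>"
  shows "x * z \<approx>\<^bsub>\<nu>\<^esub> y * z"
proof -
  have "(x - y) * (scal (Poly_Mapping.lookup z w) * word_elt w) \<in> null qe \<beta> k l \<nu>"
    if "w \<in> Poly_Mapping.keys z" for w
  proof -
    have "(x - y) * word_elt w \<in> null qe \<beta> k l \<nu>"
      using assms that by (intro null_mult_word) (auto simp: eqv_def hom_rep_def)
    then show ?thesis
      by (metis mult.assoc null.scale scal_central)
  qed
  then have "(x - y) * (\<Sum>w\<in>Poly_Mapping.keys z. scal (Poly_Mapping.lookup z w) * word_elt w) \<in> null qe \<beta> k l \<nu>"
    unfolding sum_distrib_left by (intro null_sum) auto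
  then show ?thesis
    by (simp add: eqv_def left_diff_distrib flip: free_alg_sum)
qed

section \<open>Sources and targets of products\<close>

lemma hom_rep_mult:
  assumes "x \<in> hom_rep k l \<nu>' \<mu>" and "y \<in> hom_rep k l \<nu> \<nu>'"
  shows "x * y \<in> hom_rep k l \<nu> \<mu>"
  using keys_mult[of x y] assms
  by (fastforce simp: hom_rep_def admissible_plus target_plus)

lemma hom_rep_diff: "x \<in> hom_rep k l \<nu> \<mu> \<Longrightarrow> y \<in> hom_rep k l \<nu> \<mu> \<Longrightarrow> x - y \<in> hom_rep k l \<nu> \<mu>"
  using keys_diff[of x y] by (auto simp: hom_rep_def)

lemma hom_rep_scal [simp]: "scal c \<in> hom_rep k l \<nu> \<nu>"
  by (simp add: hom_rep_def scal_def admissible_def)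

lemma hom_rep_1 [simp]: "1 \<in> hom_rep k l \<nu> \<nu>"
  using hom_rep_scal[of 1] by simp

lemma hom_rep_word: "admissible k l w \<Longrightarrow> target w \<nu> = \<mu> \<Longrightarrow> word_elt w \<in> hom_rep k l \<nu> \<mu>"
  by (simp add: hom_rep_def word_elt_def)

lemma hom_rep_EE: "i \<in> {1..<k+l} \<Longrightarrow> transfer i (i + 1) \<nu> = \<mu> \<Longrightarrow> EE i \<in> hom_rep k l \<nu> \<mu>"
  unfolding EE_def
  by (rule hom_rep_word) (auto simp: admissible_def target_def shift_transfer simp del: shift.simps)

lemma hom_rep_FF: "i \<in> {1..<k+l} \<Longrightarrow> transfer (i + 1) i \<nu> = \<mu> \<Longrightarrow> FF i \<in> hom_rep k l \<nu> \<mu>"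
  unfolding FF_def
  by (rule hom_rep_word) (auto simp: admissible_def target_def shift_transfer simp del: shift.simps)

lemma hom_rep_EE_chain: "1 \<le> a \<Longrightarrow> a \<le> c \<Longrightarrow> c \<le> k + l \<Longrightarrow> transfer a c \<nu> = \<mu> \<Longrightarrow>
    prod_list (map EE [a..<c]) \<in> hom_rep k l \<nu> \<mu>"
  unfolding prod_list_EE by (rule hom_rep_word) (auto simp: admissible_def target_EE_chain)

lemma hom_rep_EE_chain_rev: "1 \<le> a \<Longrightarrow> a \<le> c \<Longrightarrow> c \<le> k + l \<Longrightarrow> transfer a c \<nu> = \<mu> \<Longrightarrow>
    prod_list (map EE (rev [a..<c])) \<in> hom_rep k l \<nu> \<mu>"
  unfolding prod_list_EE by (rule hom_rep_word) (auto simp: admissible_def target_EE_chain_rev)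

lemma hom_rep_FF_chain: "1 \<le> a \<Longrightarrow> a \<le> c \<Longrightarrow> c \<le> k + l \<Longrightarrow> transfer c a \<nu> = \<mu> \<Longrightarrow>
    prod_list (map FF [a..<c]) \<in> hom_rep k l \<nu> \<mu>"
  unfolding prod_list_FF by (rule hom_rep_word) (auto simp: admissible_def target_FF_chain)

lemma hom_rep_FF_chain_rev: "1 \<le> a \<Longrightarrow> a \<le> c \<Longrightarrow> c \<le> k + l \<Longrightarrow> transfer c a \<nu> = \<mu> \<Longrightarrow>
    prod_list (map FF (rev [a..<c])) \<in> hom_rep k l \<nu> \<mu>"
  unfolding prod_list_FF by (rule hom_rep_word) (auto simp: admissible_def target_FF_chain_rev)

lemma mor_eqI:
  assumes "x \<in> hom_rep k l \<nu> \<mu>" and "y \<in> hom_rep k l \<nu> \<mu>" and "x \<approx>\<^bsub>\<nu>\<^esub> y"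
  shows "mor qe \<beta> k l \<nu> \<mu> x \<in> Hom qe \<beta> k l \<nu> \<mu>"
    and "mor qe \<beta> k l \<nu> \<mu> x = mor qe \<beta> k l \<nu> \<mu> y"
proof -
  show "mor qe \<beta> k l \<nu> \<mu> x \<in> Hom qe \<beta> k l \<nu> \<mu>"
    using assms(1) by (auto simp: mor_def Hom_def quotient_def)
  have "x - z \<in> null qe \<beta> k l \<nu> \<longleftrightarrow> y - z \<in> null qe \<beta> k l \<nu>" for z
    using assms(3) eqv_trans eqv_sym unfolding eqv_def by blast
  with assms(1,2) show "mor qe \<beta> k l \<nu> \<mu> x = mor qe \<beta> k l \<nu> \<mu> y"
    by (auto simp: mor_def hom_rel_def)
qed

end


section \<open>Homogeneous elements and rewriting inside products\<close>

context doubled_schur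
begin

lemma hom_rep_crossing: "fst c \<in> {1..<k+l} \<Longrightarrow> crossing qe c \<in> hom_rep k l \<nu> \<nu>"
  unfolding crossing_def
  by (auto simp: transfer_def intro!: hom_rep_diff hom_rep_mult hom_rep_EE hom_rep_FF split: prod.splits)

text \<open>These elements send every start weight to a single weight (\<open>homogD\<close>). As
  left factors they act after the part being rewritten, so a congruence can be multiplied by them
  without naming weights.\<close>

inductive homog :: "'f free_alg \<Rightarrow> bool" where
  homog_1: "homog 1"
| homog_EE: "i \<in> {1..<k+l} \<Longrightarrow> homog (EE i)"
| homog_FF: "i \<in> {1..<k+l} \<Longrightarrow> homog (FF i)"
| homog_crossing: "fst c \<in> {1..<k+l} \<Longrightarrow> homog (crossing qe c)"
| homog_mult: "homog x \<Longrightarrow> homog y \<Longrightarrow> homog (x * y)"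

lemma homogD: "homog x \<Longrightarrow> \<exists>\<mu>. x \<in> hom_rep k l (\<nu> :: 'w weight) \<mu>"
proof (induction arbitrary: \<nu> rule: homog.induct)
  case (homog_mult x y)
  then show ?case by (meson hom_rep_mult)
qed (blast intro: hom_rep_1 hom_rep_EE hom_rep_FF hom_rep_crossing)+

lemma homog_prod_list: "(\<And>y. y \<in> set ys \<Longrightarrow> homog y) \<Longrightarrow> homog (prod_list ys)"
  by (induction ys) (auto intro: homog_1 homog_mult)

lemma homog_EE_list: "set xs \<subseteq> {1..<k+l} \<Longrightarrow> homog (prod_list (map EE xs))"
  by (rule homog_prod_list) (use homog_EE in fastforce)

lemma homog_FF_list: "set xs \<subseteq> {1..<k+l} \<Longrightarrow> homog (prod_list (map FF xs))"
  by (rule homog_prod_list) (use homog_FF in fastforce)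

lemma eqv_mult_left: "x \<approx>\<^bsub>\<nu>\<^esub> y \<Longrightarrow> homog z \<Longrightarrow> z * x \<approx>\<^bsub>\<nu>\<^esub> z * y"
  using homogD eqv_mult_hom_left by metis

text \<open>The main rewriting rule: the middle factor is rewritten at the weight that the right
  factor has produced, so relations valid only at special weights can be used inside a long
  product.\<close>

lemma eqv_mult_mid:
  assumes "x \<approx>\<^bsub>\<mu>\<^esub> y" and "z \<in> hom_rep k l \<nu> \<mu>" and "homog z'"
  shows "z' * x * z \<approx>\<^bsub>\<nu>\<^esub> z' * y * z"
  using eqv_mult_right[OF eqv_mult_left[OF assms(1,3)] assms(2)] .

section \<open>Quantum integers\<close>

lemma qe_minus: "qe x * qe (- x) = 1"
  using qe_add[of x "- x"] qe_0 by simp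

lemma qint_0 [simp]: "qint qe 0 = 0"
  by (simp add: qint_def)

lemma qint_1 [simp]: "qint qe 1 = 1"
  using q_neq by (simp add: qint_def)

lemma qint_minus: "qint qe (- x) = - qint qe x"
  by (simp add: qint_def minus_divide_left)

lemma qint_2: "qint qe 2 = qe 1 + qe (- 1)"
proof -
  have "qe 2 = qe 1 * qe 1" "qe (- 2) = qe (- 1) * qe (- 1)"
    using qe_add[of 1 1] qe_add[of "- 1" "- 1"] by simp_all
  then show ?thesis
    using q_neq by (simp add: qint_def divide_simps) (simp add: algebra_simps)
qed

text \<open>Source of the kink factor: the first term comes from the scalar part of a positive
  crossing, the second from its \<open>EE i * FF i\<close> part.\<close>

lemma qint_kink: "qe (- 1) * qint qe \<beta> - qint qe (\<beta> - 1) = qe (- \<beta>)"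
proof -
  have "qe (\<beta> - 1) = qe \<beta> * qe (- 1)" "qe (- (\<beta> - 1)) = qe (- \<beta>) * qe 1"
    using qe_add[of \<beta> "- 1"] qe_add[of "- \<beta>" 1] by simp_all
  then show ?thesis
    using q_neq by (simp add: qint_def divide_simps) (simp add: algebra_simps)
qed

section \<open>Relations for a single index at weights with extreme entries\<close>

lemma eqv_relator: "r \<in> relators qe k l \<nu> \<Longrightarrow> r = x - y \<Longrightarrow> x \<approx>\<^bsub>\<nu>\<^esub> y"
  using null.relator[of k l 0 0 r qe \<nu> \<beta>] by (simp add: eqv_def admissible_def)

lemma eqv_FE:
  assumes "i \<in> {1..<k+l}"
  shows "FF i * EE i \<approx>\<^bsub>\<nu>\<^esub> EE i * FF i - scal (qint qe (\<nu> i - \<nu> (i + 1)))"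
  by (rule eqv_sym, rule eqv_relator[OF relators.commutator[OF assms assms]]) simp

lemma eqv_FE_EF:
  assumes "i \<in> {1..<k+l}" and "\<nu> i = \<nu> (i + 1)"
  shows "FF i * EE i \<approx>\<^bsub>\<nu>\<^esub> EE i * FF i"
  using eqv_FE[OF assms(1), of \<nu>] assms(2) by simp

lemma eqv_zero_word:
  assumes "target v \<nu> \<notin> weights \<beta> k l" and "admissible k l v"
  shows "word_elt v \<approx>\<^bsub>\<nu>\<^esub> 0"
  using null.zero_object[of k l 0 v \<nu> \<beta> qe] assms by (simp add: eqv_def admissible_def)

text \<open>In the second half \<open>\<beta> - (\<beta> + 1)\<close> is \<open>- 1\<close>, so both
  cases rest on \<open>- 1\<close> not being a natural number.\<close>

lemma not_weights:
  assumes "i \<in> {1..k+l}" and "i \<le> k \<Longrightarrow> \<nu> i = - 1" and "k < i \<Longrightarrow> \<nu> i = \<beta> + 1"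
  shows "\<nu> \<notin> weights \<beta> k l"
proof (cases "i \<le> k")
  case True
  then have "i \<in> {1..k}" and "\<nu> i \<notin> \<nat>"
    using assms neg_one_notin_Nats by auto
  then show ?thesis unfolding weights_def by blast
next
  case False
  then have "i \<in> {k+1..k+l}" and "\<beta> - \<nu> i \<notin> \<nat>"
    using assms neg_one_notin_Nats by auto
  then show ?thesis unfolding weights_def by blast
qed

text \<open>\<open>F\<^sub>i\<close> leads to an entry \<open>-1\<close> in the first half of the weight or \<open>\<beta> + 1\<close> in the second.\<close>

lemma eqv_EF_0:
  assumes "i \<in> {1..<k+l}" and "i \<le> k \<and> \<nu> i = 0 \<or> k \<le> i \<and> \<nu> (i + 1) = \<beta>"
  shows "EE i * FF i \<approx>\<^bsub>\<nu>\<^esub> 0"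
proof -
  have "transfer (i + 1) i \<nu> \<notin> weights \<beta> k l"
    using assms not_weights[of i "transfer (i + 1) i \<nu>"] not_weights[of "i + 1" "transfer (i + 1) i \<nu>"]
    by (auto simp: transfer_def)
  then have "FF i \<approx>\<^bsub>\<nu>\<^esub> 0"
    unfolding FF_def using assms(1)
    by (intro eqv_zero_word) (auto simp: target_def shift_transfer admissible_def simp del: shift.simps)
  from eqv_mult_left[OF this homog_EE[OF assms(1)]] show ?thesis by simp
qed

text \<open>Mirror image of \<open>eqv_EF_0\<close>: \<open>EE i\<close> lowers entry
  \<open>i + 1\<close> to \<open>- 1\<close> or raises entry \<open>i\<close> to
  \<open>\<beta> + 1\<close>.\<close>

lemma eqv_FE_0:
  assumes "i \<in> {1..<k+l}" and "i + 1 \<le> k \<and> \<nu> (i + 1) = 0 \<or> k < i \<and> \<nu> i = \<beta>"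
  shows "FF i * EE i \<approx>\<^bsub>\<nu>\<^esub> 0"
proof -
  have "transfer i (i + 1) \<nu> \<notin> weights \<beta> k l"
    using assms not_weights[of i "transfer i (i + 1) \<nu>"] not_weights[of "i + 1" "transfer i (i + 1) \<nu>"]
    by (auto simp: transfer_def)
  then have "EE i \<approx>\<^bsub>\<nu>\<^esub> 0"
    unfolding EE_def using assms(1)
    by (intro eqv_zero_word) (auto simp: target_def shift_transfer admissible_def simp del: shift.simps)
  from eqv_mult_left[OF this homog_FF[OF assms(1)]] show ?thesis by simp
qed

text \<open>As \<open>EE i * FF i\<close> vanishes, only the commutator term is left. This is how
  innermost pairs of ladders become scalars.\<close>

lemma eqv_FE_scal:
  assumes "i \<in> {1..<k+l}" and "i \<le> k \<and> \<nu> i = 0 \<or> k \<le> i \<and> \<nu> (i + 1) = \<beta>"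
  shows "FF i * EE i \<approx>\<^bsub>\<nu>\<^esub> scal (qint qe (\<nu> (i + 1) - \<nu> i))"
proof -
  have "FF i * EE i \<approx>\<^bsub>\<nu>\<^esub> EE i * FF i - scal (qint qe (\<nu> i - \<nu> (i + 1)))"
    by (rule eqv_FE[OF assms(1)])
  also have "\<dots> \<approx>\<^bsub>\<nu>\<^esub> 0 - scal (qint qe (\<nu> i - \<nu> (i + 1)))"
    by (intro eqv_diff eqv_EF_0 assms eqv_refl)
  also have "0 - scal (qint qe (\<nu> i - \<nu> (i + 1))) = scal (qint qe (\<nu> (i + 1) - \<nu> i))"
    using qint_minus[of "\<nu> i - \<nu> (i + 1)"] by (simp add: scal_minus)
  finally show ?thesis .
qed

lemma eqv_EF_scal:
  assumes "i \<in> {1..<k+l}" and "i + 1 \<le> k \<and> \<nu> (i + 1) = 0 \<or> k < i \<and> \<nu> i = \<beta>"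
  shows "EE i * FF i \<approx>\<^bsub>\<nu>\<^esub> scal (qint qe (\<nu> i - \<nu> (i + 1)))"
proof -
  have "EE i * FF i = EE i * FF i - scal (qint qe (\<nu> i - \<nu> (i + 1))) + scal (qint qe (\<nu> i - \<nu> (i + 1)))"
    by simp
  also have "\<dots> \<approx>\<^bsub>\<nu>\<^esub> FF i * EE i + scal (qint qe (\<nu> i - \<nu> (i + 1)))"
    by (intro eqv_add eqv_FE[OF assms(1), THEN eqv_sym] eqv_refl)
  also have "\<dots> \<approx>\<^bsub>\<nu>\<^esub> 0 + scal (qint qe (\<nu> i - \<nu> (i + 1)))"
    by (intro eqv_add eqv_FE_0 assms eqv_refl)
  finally show ?thesis by simp
qed


section \<open>Commuting elements\<close>

text \<open>Asking for commutation at every weight avoids following intermediate weights when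
  passing to products.\<close>

definition commute :: "'f free_alg \<Rightarrow> 'f free_alg \<Rightarrow> bool" where
  "commute x y \<longleftrightarrow> (\<forall>\<nu>. x * y \<approx>\<^bsub>\<nu>\<^esub> y * x)"

lemma commute_sym: "commute x y \<Longrightarrow> commute y x"
  by (auto simp: commute_def intro: eqv_sym)

lemma commuteD: "commute x y \<Longrightarrow> x * y \<approx>\<^bsub>\<nu>\<^esub> y * x"
  by (simp add: commute_def)

lemma commute_mult:
  assumes "commute x y" "commute x y'" "homog y" "homog y'"
  shows "commute x (y * y')"
  unfolding commute_def
proof
  fix \<nu> :: "'w weight"
  obtain \<mu> where \<mu>: "y' \<in> hom_rep k l \<nu> \<mu>"
    using homogD assms(4) by blast
  have "x * (y * y') = x * y * y'" by (simp add: mult.assoc)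
  also have "\<dots> \<approx>\<^bsub>\<nu>\<^esub> y * x * y'"
    by (rule eqv_mult_right[OF commuteD[OF assms(1)] \<mu>])
  also have "y * x * y' = y * (x * y')" by (simp add: mult.assoc)
  also have "\<dots> \<approx>\<^bsub>\<nu>\<^esub> y * (y' * x)"
    by (rule eqv_mult_left[OF commuteD[OF assms(2)] assms(3)])
  finally show "x * (y * y') \<approx>\<^bsub>\<nu>\<^esub> y * y' * x" by (simp add: mult.assoc)
qed

lemma commute_scal [simp]: "commute x (scal c)"
  by (simp add: commute_def scal_central)

lemma commute_diff: "commute x y \<Longrightarrow> commute x y' \<Longrightarrow> commute x (y - y')"
  by (simp add: commute_def right_diff_distrib left_diff_distrib eqv_diff)

lemma commute_prod_list:
  "(\<And>y. y \<in> set ys \<Longrightarrow> commute x y) \<Longrightarrow> (\<And>y. y \<in> set ys \<Longrightarrow> homog y) \<Longrightarrow> commute x (prod_list ys)"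
proof (induction ys)
  case Nil
  then show ?case using commute_scal[of x 1] by simp
qed (auto intro!: commute_mult homog_prod_list)

lemma commute_EE_FF: "i \<in> {1..<k+l} \<Longrightarrow> j \<in> {1..<k+l} \<Longrightarrow> i \<noteq> j \<Longrightarrow> commute (EE i) (FF j)"
  using eqv_relator[OF relators.commutator[of i k l j qe]] by (auto simp: commute_def)

lemmas commute_FF_EE = commute_EE_FF[THEN commute_sym]

lemma commute_EE_EE: "i \<in> {1..<k+l} \<Longrightarrow> j \<in> {1..<k+l} \<Longrightarrow> i + 1 < j \<or> j + 1 < i \<Longrightarrow> commute (EE i) (EE j)"
  using eqv_relator[OF relators.far_E[of i k l j qe]] by (auto simp: commute_def)

lemma commute_FF_FF: "i \<in> {1..<k+l} \<Longrightarrow> j \<in> {1..<k+l} \<Longrightarrow> i + 1 < j \<or> j + 1 < i \<Longrightarrow> commute (FF i) (FF j)"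
  using eqv_relator[OF relators.far_F[of i k l j qe]] by (auto simp: commute_def)

lemma commute_crossing:
  assumes "fst c \<in> {1..<k+l}" and "commute x (EE (fst c))" and "commute x (FF (fst c))"
  shows "commute x (crossing qe c)"
  unfolding crossing_def using assms
  by (auto intro!: commute_diff commute_mult homog_EE homog_FF split: prod.splits)

lemma hom_rep_braid: "(\<And>c. c \<in> set b \<Longrightarrow> fst c \<in> {1..<k+l}) \<Longrightarrow> braid_elt qe b \<in> hom_rep k l \<nu> \<nu>"
proof (induction b)
  case (Cons c b)
  have "fst c \<in> {1..<k+l}"
    using Cons.prems[of c] by simp
  moreover have "braid_elt qe b \<in> hom_rep k l \<nu> \<nu>"
    by (rule Cons.IH) (rule Cons.prems, simp)
  ultimately show ?case
    by (auto simp: braid_elt_def intro!: hom_rep_mult hom_rep_crossing)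
qed (simp add: braid_elt_def)

lemma braid_elt_append: "braid_elt qe (a @ b) = braid_elt qe b * braid_elt qe a"
  by (simp add: braid_elt_def)

lemma braid_elt_Nil [simp]: "braid_elt qe [] = 1"
  by (simp add: braid_elt_def)

lemma braid_elt_single [simp]: "braid_elt qe [c] = crossing qe c"
  by (simp add: braid_elt_def)

lemma commute_braid:
  assumes "\<And>c. c \<in> set b \<Longrightarrow> fst c \<in> {1..<k+l}"
    and "\<And>c. c \<in> set b \<Longrightarrow> commute x (EE (fst c)) \<and> commute x (FF (fst c))"
  shows "commute x (braid_elt qe b)"
  unfolding braid_elt_def using assms
  by (intro commute_prod_list) (auto intro!: commute_crossing homog_crossing)


section \<open>Chains of generators that collapse to scalars\<close>

section \<open>Ladders\<close>

text \<open>The product collapses from the innermost pair: once the other \<open>EE\<close> letters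
  have acted, entries \<open>a\<close> and \<open>a + 1\<close> are 0 and 1, where
  \<open>FF a * EE a\<close> is \<open>[1] = 1\<close>.\<close>

lemma eqv_FE_chain:
  assumes "1 \<le> a" "a \<le> c" "c \<le> k" "\<And>i. a \<le> i \<Longrightarrow> i < c \<Longrightarrow> \<nu> i = 0" "\<nu> c = 1"
  shows "prod_list (map FF (rev [a..<c])) * prod_list (map EE [a..<c]) \<approx>\<^bsub>\<nu>\<^esub> 1"
  using \<open>a \<le> c\<close> assms(1,4)
proof (induction rule: inc_induct)
  case base
  then show ?case by simp
next
  case (step a)
  let ?X = "prod_list (map FF (rev [Suc a..<c])) :: 'f free_alg"
    and ?Y = "prod_list (map EE [Suc a..<c]) :: 'f free_alg"
  let ?\<nu> = "transfer (Suc a) c \<nu>"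
  have "FF a * EE a \<approx>\<^bsub>?\<nu>\<^esub> scal (qint qe (?\<nu> (a + 1) - ?\<nu> a))"
    using step assms by (intro eqv_FE_scal) (auto simp: transfer_def)
  \<comment> \<open>For \<open>c = Suc a\<close> nothing has been transferred and the 1 is the entry
    \<open>\<nu> c\<close> itself; otherwise it has moved from \<open>c\<close> to
    \<open>a + 1\<close>.\<close>
  also have "?\<nu> (a + 1) - ?\<nu> a = 1"
    using step assms by (cases "c = Suc a") (auto simp: transfer_def)
  finally have FE: "FF a * EE a \<approx>\<^bsub>?\<nu>\<^esub> 1" by simp
  have "prod_list (map FF (rev [a..<c])) * prod_list (map EE [a..<c]) = ?X * (FF a * EE a) * ?Y"
    using step.hyps by (simp add: upt_conv_Cons mult.assoc)
  also have "\<dots> \<approx>\<^bsub>\<nu>\<^esub> ?X * 1 * ?Y"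
    using step assms
    by (intro eqv_mult_mid[OF FE] hom_rep_EE_chain homog_FF_list) auto
  also have "?X * 1 * ?Y \<approx>\<^bsub>\<nu>\<^esub> 1"
    using step.IH step.prems by simp
  finally show ?case .
qed

text \<open>The same collapse beyond entry \<open>k\<close>: a \<open>\<beta> - 1\<close> among
  entries \<open>\<beta>\<close> travels to the right, and the innermost pair sees
  \<open>\<beta> - 1\<close> next to \<open>\<beta>\<close>, which again gives
  \<open>[1]\<close>.\<close>

lemma eqv_FE_chain_dual:
  assumes "k < a" "a \<le> c" "c \<le> k + l" "\<nu> a = \<beta> - 1" "\<And>i. a < i \<Longrightarrow> i \<le> c \<Longrightarrow> \<nu> i = \<beta>"
  shows "prod_list (map FF [a..<c]) * prod_list (map EE (rev [a..<c])) \<approx>\<^bsub>\<nu>\<^esub> 1"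
  using \<open>a \<le> c\<close> assms(3,5)
proof (induction rule: dec_induct)
  case base
  then show ?case by simp
next
  case (step c)
  let ?X = "prod_list (map FF [a..<c]) :: 'f free_alg"
    and ?Y = "prod_list (map EE (rev [a..<c])) :: 'f free_alg"
  let ?\<nu> = "transfer a c \<nu>"
  have "FF c * EE c \<approx>\<^bsub>?\<nu>\<^esub> scal (qint qe (?\<nu> (c + 1) - ?\<nu> c))"
    using step assms(1-4) by (intro eqv_FE_scal) (auto simp: transfer_def)
  also have "?\<nu> (c + 1) - ?\<nu> c = 1"
    using step assms(1-4) by (cases "c = a") (auto simp: transfer_def)
  finally have FE: "FF c * EE c \<approx>\<^bsub>?\<nu>\<^esub> 1" by simp
  have "prod_list (map FF [a..<Suc c]) * prod_list (map EE (rev [a..<Suc c])) = ?X * (FF c * EE c) * ?Y"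
    using step.hyps by (simp add: mult.assoc)
  also have "\<dots> \<approx>\<^bsub>\<nu>\<^esub> ?X * 1 * ?Y"
    using step assms(1-4)
    by (intro eqv_mult_mid[OF FE] hom_rep_EE_chain_rev homog_FF_list) auto
  also have "?X * 1 * ?Y \<approx>\<^bsub>\<nu>\<^esub> 1"
    using step.IH step.prems by simp
  finally show ?case .
qed

text \<open>\<open>EE k\<close> supplies the 1 at entry \<open>k\<close> on which the letters below
  \<open>k\<close> collapse; the remaining \<open>FF k * EE k\<close> is
  \<open>[\<beta> - 0]\<close>.\<close>

lemma eqv_circle_chain:
  assumes "1 \<le> a" "a \<le> k" "0 < l" "\<And>i. a \<le> i \<Longrightarrow> i \<le> k \<Longrightarrow> \<nu> i = 0" "\<nu> (k + 1) = \<beta>"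
  shows "prod_list (map FF (rev [a..<Suc k])) * prod_list (map EE [a..<Suc k])
           \<approx>\<^bsub>\<nu>\<^esub> scal (qint qe \<beta>)"
proof -
  let ?X = "prod_list (map FF (rev [a..<k])) :: 'f free_alg"
    and ?Y = "prod_list (map EE [a..<k]) :: 'f free_alg"
  let ?\<nu> = "transfer k (k + 1) \<nu>"
  have "?X * ?Y \<approx>\<^bsub>?\<nu>\<^esub> 1"
    using assms by (intro eqv_FE_chain) (auto simp: transfer_def)
  then have "FF k * (?X * ?Y) * EE k \<approx>\<^bsub>\<nu>\<^esub> FF k * 1 * EE k"
    using assms(1-3) by (intro eqv_mult_mid) (auto intro: hom_rep_EE homog_FF)
  also have "FF k * 1 * EE k = FF k * EE k" by simp
  also have "\<dots> \<approx>\<^bsub>\<nu>\<^esub> scal (qint qe (\<nu> (k + 1) - \<nu> k))"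
    using assms by (intro eqv_FE_scal) auto
  finally show ?thesis
    using assms by (simp add: mult.assoc)
qed

text \<open>A 1 at entry \<open>a\<close> prevents the collapse from the inside. Instead the
  innermost pair is turned around and pulled out to both ends, which leaves the shorter ladder with
  the 1 moved to entry \<open>a + 1\<close>.\<close>

lemma eqv_kink_chain:
  assumes "1 \<le> a" "a \<le> k" "0 < l" "\<And>i. a < i \<Longrightarrow> i \<le> k \<Longrightarrow> \<nu> i = 0" "\<nu> a = 1" "\<nu> (k + 1) = \<beta>"
  shows "prod_list (map FF (rev [a..<Suc k])) * prod_list (map EE [a..<Suc k])
           \<approx>\<^bsub>\<nu>\<^esub> scal (qint qe (\<beta> - 1))"
  using \<open>a \<le> k\<close> assms(1,4-6)
proof (induction arbitrary: \<nu> rule: inc_induct)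
  case base
  have "FF k * EE k \<approx>\<^bsub>\<nu>\<^esub> scal (qint qe (\<nu> (k + 1) - \<nu> k))"
    using assms(3) base by (intro eqv_FE_scal) auto
  then show ?case using base by simp
next
  case (step a)
  let ?X = "prod_list (map FF (rev [Suc a..<Suc k])) :: 'f free_alg"
    and ?Y = "prod_list (map EE [Suc a..<Suc k]) :: 'f free_alg"
  let ?\<nu> = "transfer (Suc a) (Suc k) \<nu>" and ?\<mu> = "transfer (a + 1) a \<nu>"
  have a: "1 \<le> a" "a < k" "a \<in> {1..<k+l}" using step assms(3) by auto
  \<comment> \<open>Entries \<open>a\<close> and \<open>a + 1\<close> are both 1 at this weight, so
    the commutator term vanishes.\<close>
  have FE: "FF a * EE a \<approx>\<^bsub>?\<nu>\<^esub> EE a * FF a"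
    using step assms(3) by (intro eqv_FE_EF) (auto simp: transfer_def)
  have Y: "?Y \<in> hom_rep k l \<nu> ?\<nu>" and Y': "?Y \<in> hom_rep k l ?\<mu> (transfer (Suc a) (Suc k) ?\<mu>)"
    using a assms(3) by (auto intro!: hom_rep_EE_chain simp del: upt_Suc)
  have X: "homog ?X"
    using a assms(3) by (intro homog_FF_list) auto
  have cX: "commute ?X (EE a)"
    using a assms(3)
    by (intro commute_sym[OF commute_prod_list]) (auto intro!: commute_EE_FF homog_FF)
  have cY: "commute (FF a) ?Y"
    using a assms(3)
    by (intro commute_prod_list) (auto intro!: commute_FF_EE homog_EE)
  have "prod_list (map FF (rev [a..<Suc k])) * prod_list (map EE [a..<Suc k]) = ?X * (FF a * EE a) * ?Y"
    using a by (simp add: upt_conv_Cons mult.assoc del: upt_Suc)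
  also have "\<dots> \<approx>\<^bsub>\<nu>\<^esub> ?X * (EE a * FF a) * ?Y"
    by (rule eqv_mult_mid[OF FE Y X])
  also have "?X * (EE a * FF a) * ?Y = ?X * EE a * (FF a * ?Y)"
    by (simp add: mult.assoc)
  also have "\<dots> \<approx>\<^bsub>\<nu>\<^esub> ?X * EE a * (?Y * FF a)"
    by (intro eqv_mult_left[OF commuteD[OF cY]] homog_mult X homog_EE a)
  also have "\<dots> \<approx>\<^bsub>\<nu>\<^esub> EE a * ?X * (?Y * FF a)"
    by (rule eqv_mult_right[OF commuteD[OF cX] hom_rep_mult[OF Y' hom_rep_FF[OF a(3) refl]]])
  also have "EE a * ?X * (?Y * FF a) = EE a * (?X * ?Y) * FF a"
    by (simp add: mult.assoc)
  also have "\<dots> \<approx>\<^bsub>\<nu>\<^esub> EE a * scal (qint qe (\<beta> - 1)) * FF a"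
  proof (rule eqv_mult_mid[OF _ hom_rep_FF[OF a(3) refl] homog_EE[OF a(3)]])
    \<comment> \<open>\<open>FF a\<close> now acts first and has moved the 1 from \<open>a\<close>
      to \<open>a + 1\<close>, as the induction hypothesis requires.\<close>
    show "?X * ?Y \<approx>\<^bsub>?\<mu>\<^esub> scal (qint qe (\<beta> - 1))"
      using step.prems step.hyps by (intro step.IH) (auto simp: transfer_def)
  qed
  also have "\<dots> = scal (qint qe (\<beta> - 1)) * (EE a * FF a)"
    by (simp add: scal_central mult.assoc)
  also have "\<dots> \<approx>\<^bsub>\<nu>\<^esub> scal (qint qe (\<beta> - 1)) * scal (qint qe (\<nu> a - \<nu> (a + 1)))"
    using step assms(3) by (intro eqv_scal eqv_EF_scal) auto
  finally show ?case using step by simp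
qed

text \<open>The \<open>EE\<close> letters above \<open>k\<close> pass the letters below
  \<open>k\<close> and meet their \<open>FF\<close> counterparts. \<open>EE k\<close> has left
  \<open>\<beta> - 1\<close> at entry \<open>k + 1\<close>, so these cancel by
  \<open>eqv_FE_chain_dual\<close>, and only the indices up to \<open>k\<close> survive.\<close>

lemma eqv_DD_DDs:
  assumes "1 \<le> s" "s \<le> k" "s \<le> l" "\<And>i. k < i \<Longrightarrow> i \<le> k + s \<Longrightarrow> \<nu> i = \<beta>"
  shows "DD k s * DDs k s
           \<approx>\<^bsub>\<nu>\<^esub> prod_list (map FF (rev [k-s+1..<Suc k])) * prod_list (map EE [k-s+1..<Suc k])"
proof -
  let ?Fr = "prod_list (map FF [k+1..<k+s]) :: 'f free_alg"
  let ?Fl = "prod_list (map FF (rev [k-s+1..<k])) :: 'f free_alg"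
  let ?El = "prod_list (map EE [k-s+1..<k]) :: 'f free_alg"
  let ?Er = "prod_list (map EE (rev [k+1..<k+s])) :: 'f free_alg"
  let ?\<nu> = "transfer k (k + 1) \<nu>"
  have "commute ?Er (?Fl * ?El)"
    using assms
    by (intro commute_mult homog_prod_list commute_prod_list commute_sym[OF commute_prod_list])
       (auto intro!: homog_EE homog_FF commute_EE_FF commute_FF_EE commute_EE_EE)
  then have *: "commute (?Fl * ?El) ?Er" by (rule commute_sym)
  have "Suc (k - s) \<le> k"
    using assms by simp
  have Ek: "EE k \<in> hom_rep k l \<nu> ?\<nu>"
    using assms by (auto intro!: hom_rep_EE)
  have F: "homog (FF k)" "homog ?Fr" "homog (FF k * ?Fr)"
    using assms by (auto intro!: homog_mult homog_FF homog_FF_list)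
  \<comment> \<open>\<open>?Fl\<close> undoes the weight shift of \<open>?El\<close>, so the
    cancellation takes place at the weight reached right after \<open>EE k\<close>.\<close>
  have "?Fl * ?El * EE k \<in> hom_rep k l \<nu> ?\<nu>"
    using assms
    by (intro hom_rep_mult[OF hom_rep_mult[OF hom_rep_FF_chain_rev hom_rep_EE_chain[OF _ _ _ refl]] Ek])
       (auto simp: transfer_def)
  note FE = this
  have "DD k s * DDs k s = FF k * ?Fr * (?Fl * ?El * ?Er) * EE k"
    by (simp add: DD_def DDs_def mult.assoc)
  also have "\<dots> \<approx>\<^bsub>\<nu>\<^esub> FF k * ?Fr * (?Er * (?Fl * ?El)) * EE k"
    by (rule eqv_mult_mid[OF commuteD[OF *] Ek F(3)])
  also have "FF k * ?Fr * (?Er * (?Fl * ?El)) * EE k = FF k * (?Fr * ?Er) * (?Fl * ?El * EE k)"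
    by (simp add: mult.assoc)
  also have "\<dots> \<approx>\<^bsub>\<nu>\<^esub> FF k * 1 * (?Fl * ?El * EE k)"
    using assms
    by (intro eqv_mult_mid[OF eqv_FE_chain_dual FE F(1)]) (auto simp: transfer_def)
  finally show ?thesis
    using \<open>Suc (k - s) \<le> k\<close> by (simp add: mult.assoc)
qed

end


section \<open>Hecke relations at weights with entries 1\<close>

section \<open>Braid relations\<close>

context doubled_schur
begin

abbreviation UU :: "nat \<Rightarrow> 'f free_alg" where
  "UU i \<equiv> EE i * FF i"

lemma crossing_eq: "crossing qe (i, p) = scal (if p then qe (- 1) else qe 1) - UU i"
  by (simp add: crossing_def)

text \<open>The inner pair \<open>FF i * EE i\<close> acts where the entries are 0 and 2, and is
  \<open>[2]\<close> there.\<close>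

lemma UU_square:
  assumes "1 \<le> i" "i + 1 \<le> k" "\<nu> i = 1" "\<nu> (i + 1) = 1"
  shows "UU i * UU i \<approx>\<^bsub>\<nu>\<^esub> scal (qe 1 + qe (- 1)) * UU i"
proof -
  let ?\<nu> = "transfer (i + 1) i \<nu>"
  have i: "i \<in> {1..<k+l}" using assms by auto
  have "FF i * EE i \<approx>\<^bsub>?\<nu>\<^esub> scal (qint qe (?\<nu> (i + 1) - ?\<nu> i))"
    using assms by (intro eqv_FE_scal i) (auto simp: transfer_def)
  also have "?\<nu> (i + 1) - ?\<nu> i = 2"
    using assms by (simp add: transfer_def)
  finally have "EE i * (FF i * EE i) * FF i \<approx>\<^bsub>\<nu>\<^esub> EE i * scal (qint qe 2) * FF i"
    by (rule eqv_mult_mid[OF _ hom_rep_FF[OF i refl] homog_EE[OF i]])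
  then show ?thesis
    by (simp add: mult.assoc scal_central qint_2)
qed

text \<open>The scalars of the two crossings have product 1 and sum \<open>[2]\<close>, so the
  square relation cancels the linear term of the expansion.\<close>

lemma crossing_cancel:
  assumes "1 \<le> i" "i + 1 \<le> k" "\<nu> i = 1" "\<nu> (i + 1) = 1"
  shows "crossing qe (i, p) * crossing qe (i, \<not> p) \<approx>\<^bsub>\<nu>\<^esub> 1"
proof -
  let ?a = "if p then qe (- 1) else qe 1" and ?b = "if p then qe 1 else qe (- 1)"
  have *: "(scal a - U) * (scal b - U) = scal a * scal b - (scal a + scal b) * U + U * U"
    for a b and U :: "'f free_alg"
    by (simp add: algebra_simps scal_central[of U])
  have "crossing qe (i, p) * crossing qe (i, \<not> p) = scal (?a * ?b) - scal (?a + ?b) * UU i + UU i * UU i"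
    unfolding crossing_eq * by (simp add: scal_mult scal_add)
  also have "\<dots> \<approx>\<^bsub>\<nu>\<^esub> scal (?a * ?b) - scal (?a + ?b) * UU i + scal (qe 1 + qe (- 1)) * UU i"
    by (intro eqv_add eqv_refl UU_square assms)
  also have "\<dots> = 1"
    using qe_minus[of 1] by (simp add: mult.commute add.commute)
  finally show ?thesis .
qed

text \<open>Write the entries \<open>i\<close>, \<open>i + 1\<close>, \<open>i + 2\<close> as a
  triple, starting from (1,1,1). Commuting generators of different index brings
  \<open>FF i * EE i\<close> to (0,1,2), where it is 1. The remaining
  \<open>EE (i + 1) * FF (i + 1)\<close> acts at (0,2,1), and its commutator term yields the summand
  \<open>UU i\<close>.\<close>

lemma UU_braid_left:
  assumes "1 \<le> i" "i + 2 \<le> k" "\<nu> i = 1" "\<nu> (i + 1) = 1" "\<nu> (i + 2) = 1"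
  shows "UU i * UU (i + 1) * UU i \<approx>\<^bsub>\<nu>\<^esub> FF (i + 1) * UU i * EE (i + 1) + UU i"
proof -
  let ?j = "i + 1"
  have i: "i \<in> {1..<k+l}" and j: "?j \<in> {1..<k+l}" using assms by auto
  note h = hom_rep_mult hom_rep_EE[OF i refl] hom_rep_EE[OF j refl] hom_rep_FF[OF i refl] hom_rep_FF[OF j refl]
    and g = homog_mult homog_EE[OF i] homog_EE[OF j] homog_FF[OF i] homog_FF[OF j]
  have c: "FF ?j * EE i \<approx>\<^bsub>\<mu>\<^esub> EE i * FF ?j" "FF i * EE ?j \<approx>\<^bsub>\<mu>\<^esub> EE ?j * FF i" for \<mu>
    using i j by (auto intro!: commuteD commute_FF_EE)
  let ?\<nu>1 = "transfer ?j i \<nu>" and ?\<nu>2 = "transfer (?j + 1) ?j (transfer ?j i \<nu>)"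
  have FE: "FF i * EE i \<approx>\<^bsub>?\<nu>2\<^esub> 1"
  proof -
    have "FF i * EE i \<approx>\<^bsub>?\<nu>2\<^esub> scal (qint qe (?\<nu>2 (i + 1) - ?\<nu>2 i))"
      using assms by (intro eqv_FE_scal i) (auto simp: transfer_def)
    also have "?\<nu>2 (i + 1) - ?\<nu>2 i = 1"
      using assms by (simp add: transfer_def)
    finally show ?thesis by simp
  qed
  have EF: "EE ?j * FF ?j \<approx>\<^bsub>?\<nu>1\<^esub> FF ?j * EE ?j + 1"
  proof -
    have "?\<nu>1 ?j - ?\<nu>1 (?j + 1) = 1"
      using assms by (simp add: transfer_def)
    with eqv_add[OF eqv_FE[OF j, of ?\<nu>1] eqv_refl[of 1], THEN eqv_sym] show ?thesis
      by simp
  qed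
  have "UU i * UU ?j * UU i = EE i * FF i * EE ?j * (FF ?j * EE i) * FF i"
    by (simp add: mult.assoc)
  also have "\<dots> \<approx>\<^bsub>\<nu>\<^esub> EE i * FF i * EE ?j * (EE i * FF ?j) * FF i"
    by (rule eqv_mult_mid[OF c(1)]) (rule h, intro g)
  also have "\<dots> = EE i * (FF i * EE ?j) * (EE i * FF ?j * FF i)"
    by (simp add: mult.assoc)
  also have "\<dots> \<approx>\<^bsub>\<nu>\<^esub> EE i * (EE ?j * FF i) * (EE i * FF ?j * FF i)"
    by (rule eqv_mult_mid[OF c(2)]) (rule h(1)[OF h(1)[OF h(2) h(5)] h(4)], intro g)
  also have "\<dots> = EE i * EE ?j * (FF i * EE i) * (FF ?j * FF i)"
    by (simp add: mult.assoc)
  also have "\<dots> \<approx>\<^bsub>\<nu>\<^esub> EE i * EE ?j * 1 * (FF ?j * FF i)"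
    by (rule eqv_mult_mid[OF FE]) (rule h(1)[OF h(5) h(4)], intro g)
  also have "\<dots> = EE i * (EE ?j * FF ?j) * FF i"
    by (simp add: mult.assoc)
  also have "\<dots> \<approx>\<^bsub>\<nu>\<^esub> EE i * (FF ?j * EE ?j + 1) * FF i"
    by (rule eqv_mult_mid[OF EF]) (rule h, intro g)
  also have "\<dots> = EE i * FF ?j * (EE ?j * FF i) + UU i"
    by (simp add: algebra_simps)
  also have "\<dots> \<approx>\<^bsub>\<nu>\<^esub> EE i * FF ?j * (FF i * EE ?j) + UU i"
    by (intro eqv_add eqv_refl eqv_mult_left[OF eqv_sym[OF c(2)]] g)
  also have "\<dots> \<approx>\<^bsub>\<nu>\<^esub> FF ?j * EE i * (FF i * EE ?j) + UU i"
    by (rule eqv_add[OF eqv_mult_right[OF eqv_sym[OF c(1)] h(1)[OF h(4) h(3)]] eqv_refl])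
  finally show ?thesis by (simp add: mult.assoc)
qed

text \<open>Each \<open>UU\<close> is first turned around, which equal entries allow. Then
  \<open>EE (i + 1) * FF (i + 1)\<close> is 1 at (2,1,0), and the commutator term of
  \<open>FF i * EE i\<close> at (1,2,0) yields the extra summand, which is turned back at the
  end.\<close>

lemma UU_braid_right:
  assumes "1 \<le> i" "i + 2 \<le> k" "\<nu> i = 1" "\<nu> (i + 1) = 1" "\<nu> (i + 2) = 1"
  shows "UU (i + 1) * UU i * UU (i + 1) \<approx>\<^bsub>\<nu>\<^esub> FF (i + 1) * UU i * EE (i + 1) + UU (i + 1)"
proof -
  let ?j = "i + 1"
  have i: "i \<in> {1..<k+l}" and j: "?j \<in> {1..<k+l}" using assms by auto
  note h = hom_rep_mult hom_rep_EE[OF i refl] hom_rep_EE[OF j refl] hom_rep_FF[OF i refl] hom_rep_FF[OF j refl]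
    and g = homog_mult homog_EE[OF i] homog_EE[OF j] homog_FF[OF i] homog_FF[OF j]
  have c: "EE i * FF ?j \<approx>\<^bsub>\<mu>\<^esub> FF ?j * EE i" "EE ?j * FF i \<approx>\<^bsub>\<mu>\<^esub> FF i * EE ?j" for \<mu>
    using i j by (auto intro!: commuteD commute_EE_FF)
  have U: "EE i * FF i \<approx>\<^bsub>\<nu>\<^esub> FF i * EE i" "EE ?j * FF ?j \<approx>\<^bsub>\<nu>\<^esub> FF ?j * EE ?j"
    using assms i j by (auto intro!: eqv_sym[OF eqv_FE_EF] simp: numeral_2_eq_2)
  have hU: "EE i * FF i \<in> hom_rep k l \<nu> \<nu>" "EE ?j * FF ?j \<in> hom_rep k l \<nu> \<nu>"
    "FF ?j * EE ?j \<in> hom_rep k l \<nu> \<nu>"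
    using i j by (auto intro!: hom_rep_mult hom_rep_EE hom_rep_FF simp: transfer_def)
  let ?\<nu>1 = "transfer ?j (?j + 1) \<nu>" and ?\<nu>2 = "transfer i (i + 1) (transfer ?j (?j + 1) \<nu>)"
  have EF: "EE ?j * FF ?j \<approx>\<^bsub>?\<nu>2\<^esub> 1"
  proof -
    have "EE ?j * FF ?j \<approx>\<^bsub>?\<nu>2\<^esub> scal (qint qe (?\<nu>2 ?j - ?\<nu>2 (?j + 1)))"
      using assms by (intro eqv_EF_scal j) (auto simp: transfer_def)
    also have "?\<nu>2 ?j - ?\<nu>2 (?j + 1) = 1"
      using assms by (simp add: transfer_def)
    finally show ?thesis by simp
  qed
  have FE: "FF i * EE i \<approx>\<^bsub>?\<nu>1\<^esub> EE i * FF i + 1"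
  proof -
    have "?\<nu>1 i - ?\<nu>1 (i + 1) = - 1"
      using assms by (simp add: transfer_def)
    with eqv_FE[OF i, of ?\<nu>1] show ?thesis
      using qint_minus[of 1] by (simp add: scal_minus)
  qed
  have "UU ?j * UU i * UU ?j \<approx>\<^bsub>\<nu>\<^esub> UU ?j * UU i * (FF ?j * EE ?j)"
    by (rule eqv_mult_left[OF U(2)]) (intro g)
  also have "\<dots> \<approx>\<^bsub>\<nu>\<^esub> UU ?j * (FF i * EE i) * (FF ?j * EE ?j)"
    by (rule eqv_mult_mid[OF U(1) hU(3)]) (intro g)
  also have "UU ?j * (FF i * EE i) * (FF ?j * EE ?j) = UU ?j * (FF i * EE i * (FF ?j * EE ?j))"
    by (simp add: mult.assoc)
  also have "\<dots> \<approx>\<^bsub>\<nu>\<^esub> (FF ?j * EE ?j) * (FF i * EE i * (FF ?j * EE ?j))"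
    using i by (intro eqv_mult_right[OF U(2)] hom_rep_mult[OF _ hU(3)])
       (auto intro!: hom_rep_mult hom_rep_EE hom_rep_FF simp: transfer_def)
  also have "\<dots> = FF ?j * (EE ?j * FF i) * (EE i * FF ?j * EE ?j)"
    by (simp add: mult.assoc)
  also have "\<dots> \<approx>\<^bsub>\<nu>\<^esub> FF ?j * (FF i * EE ?j) * (EE i * FF ?j * EE ?j)"
    by (rule eqv_mult_mid[OF c(2)]) (rule h(1)[OF h(1)[OF h(2) h(5)] h(3)], intro g)
  also have "\<dots> = FF ?j * FF i * EE ?j * (EE i * FF ?j) * EE ?j"
    by (simp add: mult.assoc)
  also have "\<dots> \<approx>\<^bsub>\<nu>\<^esub> FF ?j * FF i * EE ?j * (FF ?j * EE i) * EE ?j"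
    by (rule eqv_mult_mid[OF c(1)]) (rule h(3), intro g)
  also have "\<dots> = FF ?j * FF i * (EE ?j * FF ?j) * (EE i * EE ?j)"
    by (simp add: mult.assoc)
  also have "\<dots> \<approx>\<^bsub>\<nu>\<^esub> FF ?j * FF i * 1 * (EE i * EE ?j)"
    by (rule eqv_mult_mid[OF EF]) (rule h(1)[OF h(2) h(3)], intro g)
  also have "\<dots> = FF ?j * (FF i * EE i) * EE ?j"
    by (simp add: mult.assoc)
  also have "\<dots> \<approx>\<^bsub>\<nu>\<^esub> FF ?j * (EE i * FF i + 1) * EE ?j"
    by (rule eqv_mult_mid[OF FE]) (rule h(3), intro g)
  also have "\<dots> = FF ?j * UU i * EE ?j + FF ?j * EE ?j"
    by (simp add: algebra_simps)
  also have "\<dots> \<approx>\<^bsub>\<nu>\<^esub> FF ?j * UU i * EE ?j + UU ?j"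
    by (intro eqv_add eqv_refl eqv_sym[OF U(2)])
  finally show ?thesis .
qed

text \<open>Multiplied by \<open>a = qe (- 1)\<close>, the square \<open>U * U\<close> in the cubic
  expansion becomes \<open>U\<close> plus \<open>a * a\<close> times \<open>U\<close>. The second
  summand makes the linear part symmetric in \<open>UU i\<close> and \<open>UU (i + 1)\<close>; the
  first cancels the extra summand of \<open>UU_braid_left\<close> or
  \<open>UU_braid_right\<close>.\<close>

lemma crossing_braid:
  assumes "1 \<le> i" "i + 2 \<le> k" "\<nu> i = 1" "\<nu> (i + 1) = 1" "\<nu> (i + 2) = 1"
  shows "crossing qe (i, True) * crossing qe (i + 1, True) * crossing qe (i, True)
    \<approx>\<^bsub>\<nu>\<^esub> crossing qe (i + 1, True) * crossing qe (i, True) * crossing qe (i + 1, True)"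
proof -
  let ?A = "scal (qe (- 1)) :: 'f free_alg" and ?Q = "scal (qe 1) :: 'f free_alg"
  let ?W = "FF (i + 1) * UU i * EE (i + 1)"
  have expand: "(?A - U) * (?A - V) * (?A - U)
      = ?A * ?A * ?A - ?A * (?A * (U + U + V)) + ?A * (U * V + V * U + U * U) - U * V * U" for U V
  proof -
    have [simp]: "U * ?A = ?A * U" "V * ?A = ?A * V" "U * (?A * X) = ?A * (U * X)" "V * (?A * X) = ?A * (V * X)" for X
      by (simp_all add: scal_central[of U] scal_central[of V] flip: mult.assoc)
    show ?thesis by (simp add: algebra_simps)
  qed
  have AQ: "?A * ((?Q + ?A) * U) = U + ?A * (?A * U)" for U
  proof -
    have "?A * ?Q = 1" using qe_minus[of 1] by (simp add: scal_mult mult.commute)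
    then show ?thesis by (simp add: algebra_simps flip: mult.assoc)
  qed
  have sq: "UU i * UU i \<approx>\<^bsub>\<nu>\<^esub> (?Q + ?A) * UU i" "UU (i + 1) * UU (i + 1) \<approx>\<^bsub>\<nu>\<^esub> (?Q + ?A) * UU (i + 1)"
    using assms UU_square[of i \<nu>] UU_square[of "i + 1" \<nu>] by (simp_all add: scal_add)
  have "(?A - UU i) * (?A - UU (i + 1)) * (?A - UU i)
      \<approx>\<^bsub>\<nu>\<^esub> ?A * ?A * ?A - ?A * (?A * (UU i + UU i + UU (i + 1)))
        + ?A * (UU i * UU (i + 1) + UU (i + 1) * UU i + (?Q + ?A) * UU i) - (?W + UU i)"
    unfolding expand by (intro eqv_add eqv_diff eqv_refl eqv_scal sq UU_braid_left assms)
  also have "\<dots> = ?A * ?A * ?A - ?A * (?A * (UU (i + 1) + UU (i + 1) + UU i))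
        + ?A * (UU (i + 1) * UU i + UU i * UU (i + 1) + (?Q + ?A) * UU (i + 1)) - (?W + UU (i + 1))"
    by (simp only: distrib_left AQ) (simp add: algebra_simps)
  also have "\<dots> \<approx>\<^bsub>\<nu>\<^esub> (?A - UU (i + 1)) * (?A - UU i) * (?A - UU (i + 1))"
    unfolding expand by (rule eqv_sym) (intro eqv_add eqv_diff eqv_refl eqv_scal sq UU_braid_right assms)
  finally show ?thesis by (simp add: crossing_eq)
qed

lemma crossing_far:
  assumes "1 \<le> i" "i + 1 < j" "j < k"
  shows "commute (crossing qe (i, p)) (crossing qe (j, r))"
  using assms
  by (intro commute_crossing commute_sym[OF commute_crossing])
     (auto intro!: commute_EE_EE commute_EE_FF commute_FF_EE commute_FF_FF)

end


section \<open>A single cap and cup around a braid\<close>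

section \<open>Closing one strand\<close>

text \<open>The bound leaves room for the largest index \<open>k + s - 1\<close> of
  \<open>DD k s\<close> and \<open>DDs k s\<close> for every \<open>s < k\<close>.\<close>

locale partially_closed = doubled_schur qe \<beta> k l
  for qe :: "'w::ring_1 \<Rightarrow> 'f::field" and \<beta> and k l :: nat +
  assumes k_le: "k \<le> Suc l"
begin

text \<open>The weight at which the strands after the \<open>n\<close>-th are closed: closing a
  strand turns a 1 of the first half into 0 and a \<open>\<beta> - 1\<close> of the second half into
  \<open>\<beta>\<close>.\<close>

definition strand_weight :: "nat \<Rightarrow> 'w weight" where
  "strand_weight n = (\<lambda>i. if 1 \<le> i \<and> i \<le> n then 1 else if k < i \<and> i \<le> k + (k - n) then \<beta>
     else if k + (k - n) < i \<and> i \<le> k + l then \<beta> - 1 else 0)"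

lemma homog_DD: "1 \<le> s \<Longrightarrow> s < k \<Longrightarrow> homog (DD k s)"
  using k_le by (auto simp: DD_def intro!: homog_mult homog_FF homog_FF_list)

lemma homog_DDs: "1 \<le> s \<Longrightarrow> s < k \<Longrightarrow> homog (DDs k s)"
  using k_le by (auto simp: DDs_def intro!: homog_mult homog_EE homog_EE_list)

text \<open>With \<open>s = k - n\<close> the lower chain starts at
  \<open>k - s + 1 = n + 1\<close>, so the cup creates exactly strand \<open>n + 1\<close>.\<close>

lemma hom_rep_DDs:
  assumes "1 \<le> n" "n < k"
  shows "DDs k (k - n) \<in> hom_rep k l (strand_weight n) (strand_weight (Suc n))"
proof -
  let ?\<nu> = "transfer k (k + 1) (strand_weight n)"
  let ?\<mu> = "transfer (k + 1) (k + (k - n)) ?\<nu>"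
  have "DDs k (k - n) \<in> hom_rep k l (strand_weight n) (transfer (k - (k - n) + 1) k ?\<mu>)"
    unfolding DDs_def using assms k_le
    by (intro hom_rep_mult[OF hom_rep_mult[OF hom_rep_EE_chain[OF _ _ _ refl] hom_rep_EE_chain_rev[OF _ _ _ refl]]]
          hom_rep_EE[OF _ refl]) auto
  also have "transfer (k - (k - n) + 1) k ?\<mu> = strand_weight (Suc n)"
    using assms k_le by (auto simp: transfer_def strand_weight_def fun_eq_iff)
  finally show ?thesis .
qed

lemma hom_rep_DD:
  assumes "1 \<le> n" "n < k"
  shows "DD k (k - n) \<in> hom_rep k l (strand_weight (Suc n)) (strand_weight n)"
proof -
  let ?\<nu> = "transfer k (k - (k - n) + 1) (strand_weight (Suc n))"
  let ?\<mu> = "transfer (k + (k - n)) (k + 1) ?\<nu>"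
  have "DD k (k - n) \<in> hom_rep k l (strand_weight (Suc n)) (transfer (k + 1) k ?\<mu>)"
    unfolding DD_def using assms k_le
    by (intro hom_rep_mult[OF hom_rep_mult[OF hom_rep_FF[OF _ refl] hom_rep_FF_chain[OF _ _ _ refl]]
          hom_rep_FF_chain_rev[OF _ _ _ refl]]) auto
  also have "transfer (k + 1) k ?\<mu> = strand_weight n"
    using assms k_le by (auto simp: transfer_def strand_weight_def fun_eq_iff)
  finally show ?thesis .
qed

text \<open>The smallest index in \<open>DD k s\<close> and \<open>DDs k s\<close> is
  \<open>k - s + 1\<close>, at distance at least 2 from \<open>i\<close>.\<close>

lemma commute_DD:
  assumes "1 \<le> s" "s < k" "1 \<le> i" "i < k - s"
  shows "commute (DD k s) (EE i)" "commute (DD k s) (FF i)" "commute (DDs k s) (EE i)" "commute (DDs k s) (FF i)"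
proof -
  have i: "i \<in> {1..<k+l}" using assms by auto
  have DD: "DD k s = prod_list (map FF (k # [k+1..<k+s] @ rev [k-s+1..<k]))"
    "DDs k s = prod_list (map EE ([k-s+1..<k] @ rev [k+1..<k+s] @ [k]))"
    by (simp_all add: DD_def DDs_def mult.assoc)
  show "commute (DD k s) (EE i)" "commute (DD k s) (FF i)" "commute (DDs k s) (EE i)" "commute (DDs k s) (FF i)"
    unfolding DD using assms k_le
    by (auto intro!: commute_sym[OF commute_prod_list] commute_EE_FF commute_EE_EE commute_FF_EE commute_FF_FF
          homog_EE homog_FF simp del: map_append append.simps list.map) (linarith+)
qed

text \<open>The index \<open>k - s\<close> is adjacent to \<open>k - s + 1\<close>, but generators
  of opposite type and different index commute even then.\<close>

lemma commute_DD_EE: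
  assumes "1 \<le> s" "s < k"
  shows "commute (DD k s) (EE (k - s))" "commute (DDs k s) (FF (k - s))"
proof -
  have DD: "DD k s = prod_list (map FF (k # [k+1..<k+s] @ rev [k-s+1..<k]))"
    "DDs k s = prod_list (map EE ([k-s+1..<k] @ rev [k+1..<k+s] @ [k]))"
    by (simp_all add: DD_def DDs_def mult.assoc)
  show "commute (DD k s) (EE (k - s))" "commute (DDs k s) (FF (k - s))"
    unfolding DD using assms k_le
    by (auto intro!: commute_sym[OF commute_prod_list] commute_EE_FF commute_FF_EE
          homog_EE homog_FF simp del: map_append append.simps list.map) (linarith+)
qed

lemma braid_word_range: "braid_word n b \<Longrightarrow> n \<le> k \<Longrightarrow> c \<in> set b \<Longrightarrow> fst c \<in> {1..<k+l}"
  by (cases c) (force simp: braid_word_def)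

lemma hom_rep_braid_word: "braid_word n b \<Longrightarrow> n \<le> k \<Longrightarrow> braid_elt qe b \<in> hom_rep k l \<nu> \<nu>"
  by (rule hom_rep_braid) (rule braid_word_range)

lemma homog_braid_word: "braid_word n b \<Longrightarrow> n \<le> k \<Longrightarrow> homog (braid_elt qe b)"
  unfolding braid_elt_def by (rule homog_prod_list) (auto intro!: homog_crossing dest: braid_word_range)

lemma commute_DD_braid:
  assumes "1 \<le> n" "n < k" "braid_word n b"
  shows "commute (DD k (k - n)) (braid_elt qe b)" "commute (DDs k (k - n)) (braid_elt qe b)"
proof -
  have *: "fst c \<in> {1..<k+l}" "1 \<le> fst c" "fst c < k - (k - n)" if "c \<in> set b" for c
    using assms that by (cases c; force simp: braid_word_def)+
  show "commute (DD k (k - n)) (braid_elt qe b)" "commute (DDs k (k - n)) (braid_elt qe b)"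
    using assms(1,2) by (intro commute_braid conjI commute_DD *; simp)+
qed

lemma DD_DDs_circle:
  assumes "1 \<le> n" "n < k"
  shows "DD k (k - n) * DDs k (k - n) \<approx>\<^bsub>strand_weight n\<^esub> scal (qint qe \<beta>)"
proof -
  have "DD k (k - n) * DDs k (k - n) \<approx>\<^bsub>strand_weight n\<^esub>
      prod_list (map FF (rev [k-(k-n)+1..<Suc k])) * prod_list (map EE [k-(k-n)+1..<Suc k])"
    using assms k_le by (intro eqv_DD_DDs) (auto simp: strand_weight_def)
  also have "\<dots> \<approx>\<^bsub>strand_weight n\<^esub> scal (qint qe \<beta>)"
    using assms k_le by (intro eqv_circle_chain) (auto simp: strand_weight_def)
  finally show ?thesis .
qed

text \<open>The scalar part of the crossing leaves a circle. In the other part \<open>EE n\<close>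
  and \<open>FF n\<close> are pulled out of the ladder, which is then evaluated by
  \<open>eqv_kink_chain\<close>; \<open>qint_kink\<close> combines the two values.\<close>

lemma DD_crossing_DDs:
  assumes "1 \<le> n" "n < k"
  shows "DD k (k - n) * crossing qe (n, True) * DDs k (k - n) \<approx>\<^bsub>strand_weight n\<^esub> scal (qe (- \<beta>))"
proof -
  let ?D = "DD k (k - n) :: 'f free_alg" and ?D' = "DDs k (k - n) :: 'f free_alg" and ?\<nu> = "strand_weight n"
  let ?\<mu> = "transfer (n + 1) n ?\<nu>"
  have n: "n \<in> {1..<k+l}" and s: "1 \<le> k - n" "k - n < k" "k - (k - n) = n" using assms by auto
  \<comment> \<open>Once moved to the right end, \<open>FF n\<close> acts first and puts the 1 at
    entry \<open>n + 1\<close>, the first index of the ladder.\<close>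
  have "?D * ?D' \<approx>\<^bsub>?\<mu>\<^esub> prod_list (map FF (rev [k-(k-n)+1..<Suc k])) * prod_list (map EE [k-(k-n)+1..<Suc k])"
    using assms k_le by (intro eqv_DD_DDs) (auto simp: strand_weight_def transfer_def)
  also have "\<dots> \<approx>\<^bsub>?\<mu>\<^esub> scal (qint qe (\<beta> - 1))"
    using assms k_le by (intro eqv_kink_chain) (auto simp: strand_weight_def transfer_def)
  finally have kink: "?D * ?D' \<approx>\<^bsub>?\<mu>\<^esub> scal (qint qe (\<beta> - 1))" .
  have "?D * UU n * ?D' = ?D * EE n * (FF n * ?D')" by (simp add: mult.assoc)
  also have "\<dots> \<approx>\<^bsub>?\<nu>\<^esub> ?D * EE n * (?D' * FF n)"
    using commute_DD_EE(2)[OF s(1,2)] s n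
    by (intro eqv_mult_left eqv_sym[OF commuteD] homog_mult homog_DD homog_EE) auto
  also have "\<dots> \<approx>\<^bsub>?\<nu>\<^esub> EE n * ?D * (?D' * FF n)"
  proof -
    obtain \<mu>' where "?D' \<in> hom_rep k l ?\<mu> \<mu>'"
      using homogD[OF homog_DDs[OF s(1,2)]] by blast
    then have "?D' * FF n \<in> hom_rep k l ?\<nu> \<mu>'"
      using n by (intro hom_rep_mult hom_rep_FF) auto
    moreover have "?D * EE n \<approx>\<^bsub>\<mu>'\<^esub> EE n * ?D"
      using commuteD[OF commute_DD_EE(1)[OF s(1,2)]] s by simp
    ultimately show ?thesis by (intro eqv_mult_right)
  qed
  also have "EE n * ?D * (?D' * FF n) = EE n * (?D * ?D') * FF n" by (simp add: mult.assoc)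
  also have "\<dots> \<approx>\<^bsub>?\<nu>\<^esub> EE n * scal (qint qe (\<beta> - 1)) * FF n"
    by (rule eqv_mult_mid[OF kink hom_rep_FF[OF n refl] homog_EE[OF n]])
  also have "\<dots> = scal (qint qe (\<beta> - 1)) * (EE n * FF n)"
    by (simp add: scal_central mult.assoc)
  also have "\<dots> \<approx>\<^bsub>?\<nu>\<^esub> scal (qint qe (\<beta> - 1)) * scal (qint qe (?\<nu> n - ?\<nu> (n + 1)))"
    using assms by (intro eqv_scal eqv_EF_scal n) (auto simp: strand_weight_def)
  also have "?\<nu> n - ?\<nu> (n + 1) = 1"
  proof -
    have "\<not> k + k - n < Suc n" using assms by linarith
    then show ?thesis using assms by (simp add: strand_weight_def)
  qed
  finally have U: "?D * UU n * ?D' \<approx>\<^bsub>?\<nu>\<^esub> scal (qint qe (\<beta> - 1))" by simp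
  have "?D * crossing qe (n, True) * ?D' = scal (qe (- 1)) * (?D * ?D') - ?D * UU n * ?D'"
    by (simp add: crossing_eq right_diff_distrib left_diff_distrib mult.assoc scal_central[of ?D])
  also have "\<dots> \<approx>\<^bsub>?\<nu>\<^esub> scal (qe (- 1)) * scal (qint qe \<beta>) - scal (qint qe (\<beta> - 1))"
    by (intro eqv_diff eqv_scal DD_DDs_circle assms U)
  also have "\<dots> = scal (qe (- \<beta>))"
    by (simp add: scal_mult scal_diff qint_kink)
  finally show ?thesis .
qed

lemma close_strand:
  assumes "1 \<le> n" "n < k" "braid_word n x"
  shows "DD k (k - n) * braid_elt qe x * DDs k (k - n)
    \<approx>\<^bsub>strand_weight n\<^esub> scal (qint qe \<beta>) * braid_elt qe x"
proof -
  have "DD k (k - n) * braid_elt qe x * DDs k (k - n) \<approx>\<^bsub>strand_weight n\<^esub>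
      braid_elt qe x * DD k (k - n) * DDs k (k - n)"
    by (rule eqv_mult_right[OF commuteD[OF commute_DD_braid(1)[OF assms]] hom_rep_DDs[OF assms(1,2)]])
  also have "\<dots> = braid_elt qe x * (DD k (k - n) * DDs k (k - n))" by (simp add: mult.assoc)
  also have "\<dots> \<approx>\<^bsub>strand_weight n\<^esub> braid_elt qe x * scal (qint qe \<beta>)"
    using assms by (intro eqv_mult_left DD_DDs_circle homog_braid_word) auto
  finally show ?thesis by (simp add: scal_central)
qed

text \<open>Braids on the first \<open>n\<close> strands commute with cap and cup, so they are moved
  outside until only the crossing is enclosed.\<close>

lemma close_strand_crossing:
  assumes "1 \<le> n" "n < k" "braid_word n x" "braid_word n y"
  shows "DD k (k - n) * braid_elt qe (x @ [(n, True)] @ y) * DDs k (k - n)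
    \<approx>\<^bsub>strand_weight n\<^esub> scal (qe (- \<beta>)) * braid_elt qe (x @ y)"
proof -
  let ?D = "DD k (k - n) :: 'f free_alg" and ?D' = "DDs k (k - n) :: 'f free_alg" and ?\<nu> = "strand_weight n" and ?c = "crossing qe (n, True)"
  let ?x = "braid_elt qe x" and ?y = "braid_elt qe y"
  have n: "fst (n, True) \<in> {1..<k+l}" using assms by auto
  note x = hom_rep_braid_word[OF assms(3) less_imp_le[OF assms(2)]]
  have "?D * braid_elt qe (x @ [(n, True)] @ y) * ?D' = ?D * ?y * ?c * (?x * ?D')"
    by (simp only: braid_elt_append braid_elt_single mult.assoc)
  also have "\<dots> \<approx>\<^bsub>?\<nu>\<^esub> ?D * ?y * ?c * (?D' * ?x)"
    using assms n commute_DD_braid(2)[OF assms(1-3)]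
    by (intro eqv_mult_left eqv_sym[OF commuteD] homog_mult homog_DD homog_braid_word[of n] homog_crossing) auto
  also have "\<dots> = ?D * ?y * (?c * (?D' * ?x))" by (simp add: mult.assoc)
  also have "\<dots> \<approx>\<^bsub>?\<nu>\<^esub> ?y * ?D * (?c * (?D' * ?x))"
    by (rule eqv_mult_right[OF commuteD[OF commute_DD_braid(1)[OF assms(1,2,4)]]
          hom_rep_mult[OF hom_rep_crossing[OF n] hom_rep_mult[OF hom_rep_DDs[OF assms(1,2)] x]]])
  also have "\<dots> = ?y * (?D * ?c * ?D') * ?x" by (simp add: mult.assoc)
  also have "\<dots> \<approx>\<^bsub>?\<nu>\<^esub> ?y * scal (qe (- \<beta>)) * ?x"
    using assms by (intro eqv_mult_mid[OF DD_crossing_DDs x] homog_braid_word[of n]) auto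
  finally show ?thesis by (simp add: braid_elt_append scal_central mult.assoc)
qed

section \<open>Closing strands 2 to n of a braid on n strands\<close>

definition partial_trace :: "nat \<Rightarrow> braid \<Rightarrow> 'f free_alg" where
  "partial_trace n b = prod_list (map (DD k) (rev [k-n+1..<k])) * braid_elt qe b * prod_list (map (DDs k) [k-n+1..<k])"

lemma partial_trace_1: "partial_trace 1 [] = 1"
  unfolding partial_trace_def by (cases k) simp_all

text \<open>Strand \<open>n + 1\<close> is closed by the innermost factors, those with the smallest
  index \<open>k - n\<close>; here they are isolated.\<close>

lemma partial_trace_Suc:
  assumes "1 \<le> n" "n < k"
  shows "partial_trace (Suc n) b = prod_list (map (DD k) (rev [k-n+1..<k]))
    * (DD k (k - n) * braid_elt qe b * DDs k (k - n)) * prod_list (map (DDs k) [k-n+1..<k])"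
proof -
  have "[k - Suc n + 1..<k] = (k - n) # [k-n+1..<k]"
    using assms by (simp add: Suc_diff_Suc flip: upt_conv_Cons)
  then show ?thesis by (simp add: partial_trace_def mult.assoc)
qed

lemma hom_rep_closers:
  assumes "1 \<le> n" "n \<le> k"
  shows "prod_list (map (DDs k) [k-n+1..<k]) \<in> hom_rep k l (strand_weight 1) (strand_weight n)"
    and "prod_list (map (DD k) (rev [k-n+1..<k])) \<in> hom_rep k l (strand_weight n) (strand_weight 1)"
    and "homog (prod_list (map (DD k) (rev [k-n+1..<k])))"
proof -
  show "homog (prod_list (map (DD k) (rev [k-n+1..<k])))"
    using assms by (intro homog_prod_list) (auto intro!: homog_DD)
  have "prod_list (map (DDs k) [k-n+1..<k]) \<in> hom_rep k l (strand_weight 1) (strand_weight n) \<and>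
    prod_list (map (DD k) (rev [k-n+1..<k])) \<in> hom_rep k l (strand_weight n) (strand_weight 1)"
    using assms
  proof (induction n rule: dec_induct)
    case base
    have "[k - 1 + 1..<k] = []" by (cases k) simp_all
    then show ?case by simp
  next
    case (step n)
    then have "[k - Suc n + 1..<k] = (k - n) # [k-n+1..<k]"
      by (simp add: Suc_diff_Suc flip: upt_conv_Cons)
    then show ?case
      using step hom_rep_DDs[of n] hom_rep_DD[of n] by (auto intro: hom_rep_mult)
  qed
  then show "prod_list (map (DDs k) [k-n+1..<k]) \<in> hom_rep k l (strand_weight 1) (strand_weight n)"
    and "prod_list (map (DD k) (rev [k-n+1..<k])) \<in> hom_rep k l (strand_weight n) (strand_weight 1)"
    by auto
qed

lemma partial_trace_cong:
  assumes "1 \<le> n" "n \<le> k" "braid_elt qe b \<approx>\<^bsub>strand_weight n\<^esub> braid_elt qe b'"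
  shows "partial_trace n b \<approx>\<^bsub>strand_weight 1\<^esub> partial_trace n b'"
  unfolding partial_trace_def using hom_rep_closers[OF assms(1,2)] by (intro eqv_mult_mid[OF assms(3)])

text \<open>Markov property for a strand that meets no crossing. Together with
  \<open>partial_trace_kink\<close> and the skein and braid relations it determines the trace by
  induction on the number of strands.\<close>

lemma partial_trace_add_strand:
  assumes "1 \<le> n" "n < k" "braid_word n x"
  shows "partial_trace (Suc n) x \<approx>\<^bsub>strand_weight 1\<^esub> scal (qint qe \<beta>) * partial_trace n x"
proof -
  let ?R = "prod_list (map (DDs k) [k-n+1..<k]) :: 'f free_alg" and ?L = "prod_list (map (DD k) (rev [k-n+1..<k])) :: 'f free_alg"
  have "partial_trace (Suc n) x \<approx>\<^bsub>strand_weight 1\<^esub> ?L * (scal (qint qe \<beta>) * braid_elt qe x) * ?R"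
    unfolding partial_trace_Suc[OF assms(1,2)] using assms
    by (intro eqv_mult_mid[OF close_strand] hom_rep_closers) auto
  also have "\<dots> = scal (qint qe \<beta>) * partial_trace n x"
    unfolding partial_trace_def mult.assoc[symmetric] by (simp add: scal_central)
  finally show ?thesis .
qed

lemma partial_trace_kink:
  assumes "1 \<le> n" "n < k" "braid_word n x" "braid_word n y"
  shows "partial_trace (Suc n) (x @ [(n, True)] @ y) \<approx>\<^bsub>strand_weight 1\<^esub> scal (qe (- \<beta>)) * partial_trace n (x @ y)"
proof -
  let ?R = "prod_list (map (DDs k) [k-n+1..<k]) :: 'f free_alg" and ?L = "prod_list (map (DD k) (rev [k-n+1..<k])) :: 'f free_alg"
  have "partial_trace (Suc n) (x @ [(n, True)] @ y)
      \<approx>\<^bsub>strand_weight 1\<^esub> ?L * (scal (qe (- \<beta>)) * braid_elt qe (x @ y)) * ?R"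
    unfolding partial_trace_Suc[OF assms(1,2)] using assms
    by (intro eqv_mult_mid[OF close_strand_crossing] hom_rep_closers) auto
  also have "\<dots> = scal (qe (- \<beta>)) * partial_trace n (x @ y)"
    unfolding partial_trace_def mult.assoc[symmetric] by (simp add: scal_central)
  finally show ?thesis .
qed

end


section \<open>Reduction to at most one occurrence of the last generator\<close>

section \<open>Generating braid words by skein relations\<close>

lemma braid_word_simps [simp]:
  "braid_word n []"
  "braid_word n (c # b) \<longleftrightarrow> 1 \<le> fst c \<and> fst c < n \<and> braid_word n b"
  "braid_word n (a @ b) \<longleftrightarrow> braid_word n a \<and> braid_word n b"
  by (auto simp: braid_word_def split: prod.splits)

lemma braid_word_mono: "braid_word n b \<Longrightarrow> n \<le> m \<Longrightarrow> braid_word m b"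
  by (auto simp: braid_word_def)

text \<open>Rules obeyed by both traces, so the words on which these agree form such a set. The last
  rule is the skein relation: the smoothed word and one sign of a crossing determine the other
  sign.\<close>

definition skein_closed :: "nat \<Rightarrow> braid set \<Rightarrow> bool" where
  "skein_closed n G \<longleftrightarrow> (\<forall>A B. braid_word n A \<and> braid_word n B \<longrightarrow>
     (\<forall>i j p r. 1 \<le> i \<and> 1 \<le> j \<and> i < n \<and> j < n \<and> (i + 1 < j \<or> j + 1 < i) \<and> A @ [(i, p), (j, r)] @ B \<in> G
        \<longrightarrow> A @ [(j, r), (i, p)] @ B \<in> G) \<and>
     (\<forall>i. 1 \<le> i \<and> i + 1 < n \<and> A @ [(i, True), (i + 1, True), (i, True)] @ B \<in> G
        \<longrightarrow> A @ [(i + 1, True), (i, True), (i + 1, True)] @ B \<in> G) \<and>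
     (\<forall>i. 1 \<le> i \<and> i < n \<and> A @ B \<in> G \<longrightarrow> A @ [(i, True), (i, False)] @ B \<in> G) \<and>
     (\<forall>i p. 1 \<le> i \<and> i < n \<and> A @ B \<in> G \<and> A @ [(i, p)] @ B \<in> G
        \<longrightarrow> A @ [(i, \<not> p)] @ B \<in> G))"

lemma skein_closed_far:
  "skein_closed n G \<Longrightarrow> braid_word n A \<Longrightarrow> braid_word n B \<Longrightarrow> 1 \<le> i \<Longrightarrow> 1 \<le> j \<Longrightarrow> i < n \<Longrightarrow> j < n \<Longrightarrow>
    i + 1 < j \<or> j + 1 < i \<Longrightarrow> A @ [(i, p), (j, r)] @ B \<in> G \<Longrightarrow> A @ [(j, r), (i, p)] @ B \<in> G"
  unfolding skein_closed_def by blast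

lemma skein_closed_braid:
  "skein_closed n G \<Longrightarrow> braid_word n A \<Longrightarrow> braid_word n B \<Longrightarrow> 1 \<le> i \<Longrightarrow> i + 1 < n \<Longrightarrow>
    A @ [(i, True), (i + 1, True), (i, True)] @ B \<in> G \<Longrightarrow>
    A @ [(i + 1, True), (i, True), (i + 1, True)] @ B \<in> G"
  unfolding skein_closed_def by blast

lemma skein_closed_cancel:
  "skein_closed n G \<Longrightarrow> braid_word n A \<Longrightarrow> braid_word n B \<Longrightarrow> 1 \<le> i \<Longrightarrow> i < n \<Longrightarrow>
    A @ B \<in> G \<Longrightarrow> A @ [(i, True), (i, False)] @ B \<in> G"
  unfolding skein_closed_def by blast

lemma skein_closed_skein:
  assumes "skein_closed n G" "braid_word n A" "braid_word n B" "1 \<le> i" "i < n"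
    "A @ B \<in> G" "A @ [(i, p)] @ B \<in> G"
  shows "A @ [(i, r)] @ B \<in> G"
proof (cases "r = p")
  case False
  then have "r = (\<not> p)" by auto
  with assms show ?thesis unfolding skein_closed_def by blast
qed (use assms in simp)

text \<open>Insert a cancelling pair and switch the sign of its second crossing; the smoothing that
  the skein rule asks for is the word with a single \<open>(i, True)\<close>.\<close>

lemma skein_closed_square:
  assumes "skein_closed n G" "braid_word n A" "braid_word n B" "1 \<le> i" "i < n"
    "A @ B \<in> G" "A @ [(i, True)] @ B \<in> G"
  shows "A @ [(i, True), (i, True)] @ B \<in> G"
  using skein_closed_skein[of n G "A @ [(i, True)]" B i False True] skein_closed_cancel[of n G A B i] assms
  by simp

text \<open>With a fixed context the set becomes one for possibly fewer strands, so an induction on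
  strands can act on the middle of a word.\<close>

lemma skein_closed_context:
  assumes "skein_closed n G" "braid_word n C" "braid_word n D" "m \<le> n"
  shows "skein_closed m {b. C @ b @ D \<in> G}"
  unfolding skein_closed_def
proof (intro allI impI conjI; elim conjE)
  fix A B assume AB: "braid_word m A" "braid_word m B"
  then have w: "braid_word n (C @ A)" "braid_word n (B @ D)"
    using assms braid_word_mono by auto
  show "A @ [(j, r), (i, p)] @ B \<in> {b. C @ b @ D \<in> G}"
    if "1 \<le> i" "1 \<le> j" "i < m" "j < m" "i + 1 < j \<or> j + 1 < i" "A @ [(i, p), (j, r)] @ B \<in> {b. C @ b @ D \<in> G}" for i j p r
    using skein_closed_far[OF assms(1) w, of i j p r] that assms(4) by simp
  show "A @ [(i + 1, True), (i, True), (i + 1, True)] @ B \<in> {b. C @ b @ D \<in> G}"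
    if "1 \<le> i" "i + 1 < m" "A @ [(i, True), (i + 1, True), (i, True)] @ B \<in> {b. C @ b @ D \<in> G}" for i
    using skein_closed_braid[OF assms(1) w, of i] that assms(4) by simp
  show "A @ [(i, True), (i, False)] @ B \<in> {b. C @ b @ D \<in> G}"
    if "1 \<le> i" "i < m" "A @ B \<in> {b. C @ b @ D \<in> G}" for i
    using skein_closed_cancel[OF assms(1) w, of i] that assms(4) by simp
  show "A @ [(i, \<not> p)] @ B \<in> {b. C @ b @ D \<in> G}"
    if "1 \<le> i" "i < m" "A @ B \<in> {b. C @ b @ D \<in> G}" "A @ [(i, p)] @ B \<in> {b. C @ b @ D \<in> G}" for i p
    using skein_closed_skein[OF assms(1) w, of i p "\<not> p"] that assms(4) by simp
qed

text \<open>Indices in \<open>x\<close> are at most \<open>g - 2\<close>, so all its letters are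
  distant from \<open>g\<close>; the last one is adjacent to the crossing and is exchanged
  first.\<close>

lemma skein_closed_pass_left:
  assumes "skein_closed (Suc g) G" "braid_word (Suc g) A" "braid_word (g - 1) x" "braid_word (Suc g) B"
    "A @ x @ [(g, r)] @ B \<in> G"
  shows "A @ [(g, r)] @ x @ B \<in> G"
  using assms(3,4,5)
proof (induction x arbitrary: B rule: rev_induct)
  case Nil
  then show ?case by simp
next
  case (snoc c x)
  have c: "1 \<le> fst c" "fst c + 1 < g" and x: "braid_word (g - 1) x"
    using snoc.prems(1) by auto
  then have x': "braid_word (Suc g) x"
    using braid_word_mono[of "g - 1" x] by simp
  have "(A @ x) @ [(fst c, snd c), (g, r)] @ B \<in> G"
    using snoc.prems(3) by simp
  then have "(A @ x) @ [(g, r), (fst c, snd c)] @ B \<in> G"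
    using assms(1,2) x' c snoc.prems(2) by - (rule skein_closed_far[OF assms(1)], auto)
  then have "A @ x @ [(g, r)] @ (c # B) \<in> G"
    by simp
  then have "A @ [(g, r)] @ x @ (c # B) \<in> G"
    using c snoc.prems(2) by (intro snoc.IH x) auto
  then show ?case by simp
qed

lemma skein_closed_pass_right:
  assumes "skein_closed (Suc g) G" "braid_word (Suc g) A" "braid_word (g - 1) x" "braid_word (Suc g) B"
    "A @ [(g, r)] @ x @ B \<in> G"
  shows "A @ x @ [(g, r)] @ B \<in> G"
  using assms(3,4,5)
proof (induction x arbitrary: B rule: rev_induct)
  case Nil
  then show ?case by simp
next
  case (snoc c x)
  have c: "1 \<le> fst c" "fst c + 1 < g" and x: "braid_word (g - 1) x"
    using snoc.prems(1) by auto
  then have x': "braid_word (Suc g) x"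
    using braid_word_mono[of "g - 1" x] by simp
  have "A @ [(g, r)] @ x @ (c # B) \<in> G"
    using snoc.prems(3) by simp
  then have "A @ x @ [(g, r)] @ (c # B) \<in> G"
    using c snoc.prems(2) by (intro snoc.IH x) auto
  then have "(A @ x) @ [(g, r), (fst c, snd c)] @ B \<in> G"
    by simp
  then have "(A @ x) @ [(fst c, snd c), (g, r)] @ B \<in> G"
    using assms(1,2) x' c snoc.prems(2) by - (rule skein_closed_far[OF assms(1)], auto)
  then show ?case by simp
qed

text \<open>The split is at the first letter of index \<open>g\<close>; later ones may remain in
  \<open>y\<close>.\<close>

lemma braid_word_Suc_split:
  assumes "braid_word (Suc g) w" "\<not> braid_word g w"
  shows "\<exists>x p y. w = x @ [(g, p)] @ y \<and> braid_word g x \<and> braid_word (Suc g) y"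
  using assms
proof (induction w)
  case Nil
  then show ?case by simp
next
  case (Cons c w)
  show ?case
  proof (cases "fst c = g")
    case True
    then have "c # w = [] @ [(g, snd c)] @ w" by (cases c) simp
    then show ?thesis using Cons.prems by fastforce
  next
    case False
    then have c: "1 \<le> fst c" "fst c < g" and "braid_word (Suc g) w" "\<not> braid_word g w"
      using Cons.prems by auto
    then obtain x p y where w: "w = x @ [(g, p)] @ y" "braid_word g x" "braid_word (Suc g) y"
      using Cons.IH by blast
    then have "c # w = (c # x) @ [(g, p)] @ y" "braid_word g (c # x)"
      using c by simp_all
    then show ?thesis using w(3) by blast
  qed
qed

text \<open>Both signs are counted; this is the measure of the inner induction on words.\<close>

definition occurrences :: "nat \<Rightarrow> braid \<Rightarrow> nat" where
  "occurrences g b = length (filter (\<lambda>c. fst c = g) b)"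

lemma occurrences_simps [simp]:
  "occurrences g [] = 0"
  "occurrences g (c # b) = (if fst c = g then 1 else 0) + occurrences g b"
  "occurrences g (a @ b) = occurrences g a + occurrences g b"
  by (simp_all add: occurrences_def)

lemma occurrences_eq_0: "braid_word g b \<Longrightarrow> occurrences g b = 0"
  by (induction b) auto

text \<open>
  The words listed in the hypotheses are those on which a Markov trace is computed from fewer
  strands. Between two occurrences of \<open>\<sigma>\<^sub>g\<close> the same statement for fewer strands reduces the word to
  one without \<open>\<sigma>\<^sub>g\<^sub>-\<^sub>1\<close>, where the two occurrences meet, or with a single \<open>\<sigma>\<^sub>g\<^sub>-\<^sub>1\<close>, where the
  braid relation applies; in both cases \<open>\<sigma>\<^sub>g\<close> occurs less often.
\<close>

theorem skein_closed_generates: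
  assumes "skein_closed (Suc g) G"
    and "\<And>x. braid_word g x \<Longrightarrow> x \<in> G"
    and "\<And>x y. 1 \<le> g \<Longrightarrow> braid_word g x \<Longrightarrow> braid_word g y \<Longrightarrow> x @ [(g, True)] @ y \<in> G"
    and "braid_word (Suc g) b"
  shows "b \<in> G"
  using assms
proof (induction g arbitrary: G b)
  case 0
  then have "braid_word 0 b" by (auto simp: braid_word_def)
  with 0 show ?case by blast
next
  case (Suc h)
  let ?g = "Suc h"
  note G = \<open>skein_closed (Suc ?g) G\<close>
  from Suc.prems(4) show ?case
  proof (induction "occurrences ?g b" arbitrary: b rule: less_induct)
    case less
    have mono: "braid_word (Suc ?g) x" if "braid_word ?g x" for x
      using braid_word_mono that by auto
    show ?case
    proof (cases "braid_word ?g b")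
      case True
      then show ?thesis by (rule Suc.prems(2))
    next
      case False
      with less.prems obtain A p r where b: "b = A @ [(?g, p)] @ r" "braid_word ?g A" "braid_word (Suc ?g) r"
        using braid_word_Suc_split by blast
      have A: "braid_word (Suc ?g) A" using mono b by simp
      \<comment> \<open>Deleting the first \<open>?g\<close> lowers the count. With this smoothing
        the skein rule adjusts the sign of that crossing at the end, so it may be taken positive
        until then.\<close>
      have Ar: "A @ r \<in> G"
        using A b by (intro less.hyps) auto
      have "A @ [(?g, True)] @ r \<in> G"
      proof (cases "braid_word ?g r")
        case True
        then show ?thesis using Suc.prems(3) b(2) by simp
      next
        case False
        with b(3) obtain x p' B where r: "r = x @ [(?g, p')] @ B" "braid_word ?g x" "braid_word (Suc ?g) B"
          using braid_word_Suc_split by blast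
        \<comment> \<open>The words allowed between two positive letters \<open>?g\<close>. They
          form a skein-closed set for one strand fewer, so the outer induction hypothesis applies
          once its two generating shapes are checked.\<close>
        define G' where "G' = {x. (A @ [(?g, True)]) @ x @ ([(?g, True)] @ B) \<in> G}"
        have occ: "occurrences ?g b = 2 + occurrences ?g B"
          using b r by (simp add: occurrences_eq_0)
        have smaller: "w \<in> G" if "braid_word (Suc ?g) w" "occurrences ?g w < 2 + occurrences ?g B" for w
          using less.hyps that occ by simp
        have "x \<in> G'"
        proof (rule Suc.IH)
          show "skein_closed (Suc h) G'"
            unfolding G'_def using A r by (intro skein_closed_context[OF G]) auto
          show "braid_word (Suc h) x" by fact
          show "y \<in> G'" if y: "braid_word h y" for y
          proof -
            have y': "braid_word ?g y" "braid_word (Suc ?g) y"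
              using braid_word_mono y by auto
            have "(A @ y) @ [(?g, True), (?g, True)] @ B \<in> G"
              using A r b y' by (intro skein_closed_square[OF G] smaller) (auto simp: occurrences_eq_0)
            then have "A @ [(?g, True)] @ y @ ([(?g, True)] @ B) \<in> G"
              using A r y by (intro skein_closed_pass_left[OF G]) auto
            then show ?thesis by (simp add: G'_def)
          qed
          show "y @ [(h, True)] @ z \<in> G'" if h: "1 \<le> h" and y: "braid_word h y" and z: "braid_word h z" for y z
          proof -
            have y': "braid_word ?g y" "braid_word (Suc ?g) y" and z': "braid_word ?g z" "braid_word (Suc ?g) z"
              using braid_word_mono y z by auto
            have "(A @ y) @ [(h, True), (h + 1, True), (h, True)] @ (z @ B) \<in> G"
              using A r b y' z' h by (intro smaller) (auto simp: occurrences_eq_0)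
            then have "(A @ y) @ [(h + 1, True), (h, True), (h + 1, True)] @ (z @ B) \<in> G"
              using A r y' z' h by (intro skein_closed_braid[OF G]) auto
            then have "A @ y @ [(?g, True)] @ ([(h, True), (?g, True)] @ z @ B) \<in> G"
              by simp
            then have "A @ [(?g, True)] @ y @ ([(h, True), (?g, True)] @ z @ B) \<in> G"
              using A r y z' h by (intro skein_closed_pass_left[OF G]) auto
            then have *: "(A @ [(?g, True)] @ y @ [(h, True)]) @ [(?g, True)] @ z @ B \<in> G"
              by simp
            have "(A @ [(?g, True)] @ y @ [(h, True)]) @ z @ [(?g, True)] @ B \<in> G"
              using * A r y y' z h by (intro skein_closed_pass_right[OF G]) auto
            then show ?thesis by (simp add: G'_def)
          qed
        qed
        then have both: "A @ [(?g, True)] @ x @ [(?g, True)] @ B \<in> G"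
          by (simp add: G'_def)
        \<comment> \<open>This smoothing at the second \<open>?g\<close> has a smaller count; it
          lets the skein rule restore the actual sign \<open>p'\<close>.\<close>
        have "(A @ [(?g, True)] @ x) @ B \<in> G"
          using A r mono b by (intro smaller) (auto simp: occurrences_eq_0)
        then have "(A @ [(?g, True)] @ x) @ [(?g, p')] @ B \<in> G"
          using A r mono both by (auto intro: skein_closed_skein[OF G, of "A @ [(?g, True)] @ x" B ?g True, simplified])
        then show ?thesis by (simp add: r)
      qed
      then have "A @ [(?g, p)] @ r \<in> G"
        using A b Ar by (auto intro: skein_closed_skein[OF G, of A r ?g True, simplified])
      then show ?thesis by (simp add: b)
    qed
  qed
qed


section \<open>Diagrams of braid closures\<close>

lemma tangle_append: "tangle X s t \<Longrightarrow> tangle Y t r \<Longrightarrow> tangle (X @ Y) s r"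
  by (induction rule: tangle.induct) (auto intro: tangle.intros)

lemma layer_cupI: "length s = i \<Longrightarrow> x = s @ t \<Longrightarrow> y = s @ [u, \<not> u] @ t \<Longrightarrow> layer (i, Cup u) x y"
  using layer.cup by blast

lemma layer_capI: "length s = i \<Longrightarrow> x = s @ [u, \<not> u] @ t \<Longrightarrow> y = s @ t \<Longrightarrow> layer (i, Cap) x y"
  using layer.cap by blast

lemma layer_crossI:
  "length s = i \<Longrightarrow> x = s @ [u, v] @ t \<Longrightarrow> y = s @ [v, u] @ t \<Longrightarrow> layer (i, Cross c) x y"
  using layer.cross by blast

lemma split_two: "Suc i < length s \<Longrightarrow> s = take i s @ [s ! i, s ! Suc i] @ drop (i + 2) s"
  by (simp add: id_take_nth_drop[symmetric] Cons_nth_drop_Suc)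

lemma layer_cross_parallel:
  assumes "Suc i < length s" "s ! i = s ! Suc i"
  shows "layer (i, Cross c) s s"
  using assms split_two[of i s] by (intro layer_crossI[of "take i s"]) auto

text \<open>Generator \<open>i\<close> crosses strands \<open>i\<close> and \<open>i + 1\<close>, so
  \<open>i - 1\<close> strands lie to its left.\<close>

definition crossings :: "braid \<Rightarrow> diagram" where
  "crossings b = map (\<lambda>(i, p). (i - 1, Cross p)) b"

definition cups :: "nat \<Rightarrow> diagram" where
  "cups n = map (\<lambda>i. (i, Cup True)) [0..<n]"

definition caps :: "nat \<Rightarrow> diagram" where
  "caps n = map (\<lambda>i. (i, Cap)) (rev [0..<n])"

text \<open>Orientations at the level of the braid: braid strands go up on the left, closing strands
  go down on the right.\<close>

definition up_down :: "nat \<Rightarrow> bool list" where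
  "up_down n = replicate n True @ replicate n False"

lemma crossings_simps [simp]:
  "crossings [] = []"
  "crossings (c # b) = (fst c - 1, Cross (snd c)) # crossings b"
  "crossings (a @ b) = crossings a @ crossings b"
  by (auto simp: crossings_def split: prod.splits)

lemma cups_Suc: "cups (Suc n) = cups n @ [(n, Cup True)]"
  by (simp add: cups_def)

lemma caps_Suc: "caps (Suc n) = (n, Cap) # caps n"
  by (simp add: caps_def)

lemma braid_closure_eq: "braid_closure n b = cups n @ crossings b @ caps n"
  by (simp add: braid_closure_def cups_def caps_def crossings_def)

lemma up_down_Suc: "up_down (Suc n) = replicate n True @ [True, False] @ replicate n False"
  by (simp add: up_down_def replicate_append_same)

lemma up_down_nth: "i < 2 * n \<Longrightarrow> up_down n ! i \<longleftrightarrow> i < n"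
  by (auto simp: up_down_def nth_append)

lemma length_up_down [simp]: "length (up_down n) = 2 * n"
  by (simp add: up_down_def)

lemma layer_up_down:
  "layer (n, Cup True) (up_down n) (up_down (Suc n))" "layer (n, Cap) (up_down (Suc n)) (up_down n)"
proof -
  show "layer (n, Cup True) (up_down n) (up_down (Suc n))"
    by (rule layer_cupI[of "replicate n True" _ _ "replicate n False"])
       (simp_all add: up_down_def replicate_append_same)
  show "layer (n, Cap) (up_down (Suc n)) (up_down n)"
    by (rule layer_capI[of "replicate n True" _ _ True "replicate n False"])
       (simp_all add: up_down_def replicate_append_same)
qed

section \<open>Exchanging the heights of distant pieces\<close>

lemma local_move_cross_far:
  assumes "i + 2 \<le> j"
  shows "local_move [(i, Cross c), (j, Q)] [(j, Q), (i, Cross c)]"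
proof -
  obtain m where "j = i + 2 + m" using assms le_Suc_ex by blast
  then show ?thesis using local_move.far[of i "Cross c" m Q] by simp
qed

text \<open>A piece to the right of a cup has two more strands on its left when it stands above the
  cup than when it stands below.\<close>

lemma local_move_cup_far:
  assumes "i \<le> j"
  shows "local_move [(i, Cup u), (j + 2, Q)] [(j, Q), (i, Cup u)]"
proof -
  obtain m where "j = i + m" using assms le_Suc_ex by blast
  then show ?thesis using local_move.far[of i "Cup u" m Q] by simp
qed

lemma local_move_cap_far:
  assumes "i \<le> j"
  shows "local_move [(i, Cap), (j, Q)] [(j + 2, Q), (i, Cap)]"
proof -
  obtain m where "j = i + m" using assms le_Suc_ex by blast
  then show ?thesis using local_move.far[of i Cap m Q] by simp
qed

lemma tangle_single: "layer x s t \<Longrightarrow> tangle [x] s t"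
  by (auto intro: tangle.intros)

lemma tangle_cups: "tangle (cups n) [] (up_down n)"
proof (induction n)
  case 0
  then show ?case by (simp add: cups_def up_down_def tangle.Nil)
next
  case (Suc n)
  then show ?case
    unfolding cups_Suc by (rule tangle_append) (rule tangle_single[OF layer_up_down(1)])
qed

lemma tangle_caps: "tangle (caps n) (up_down n) []"
proof (induction n)
  case 0
  then show ?case by (simp add: caps_def up_down_def tangle.Nil)
next
  case (Suc n)
  then show ?case
    unfolding caps_Suc by (rule tangle.Cons[OF layer_up_down(2)])
qed

lemma tangle_crossings:
  assumes "braid_word n b" "n \<le> length s" "\<And>i. i < n \<Longrightarrow> s ! i"
  shows "tangle (crossings b) s s"
  using assms(1)
proof (induction b)
  case Nil
  then show ?case by (simp add: tangle.Nil)
next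
  case (Cons c b)
  then have "layer (fst c - 1, Cross (snd c)) s s"
    using assms(2,3) by (intro layer_cross_parallel) auto
  then show ?case using Cons by (auto intro: tangle.Cons)
qed

lemma tangle_crossings_up_down: "braid_word n b \<Longrightarrow> n \<le> m \<Longrightarrow> tangle (crossings b) (up_down m) (up_down m)"
  by (rule tangle_crossings) (auto simp: up_down_nth)


section \<open>Local equality of diagrams under a framed invariant\<close>

locale framed_invariant =
  fixes qe :: "'w::ring_1 \<Rightarrow> 'f::field" and \<beta> :: 'w and H :: "diagram \<Rightarrow> 'f"
  assumes homfly: "framed_homfly qe \<beta> H"
begin

lemmas isotopy = homfly[unfolded framed_homfly_def, THEN conjunct1, rule_format, OF conjI[OF _ conjI]]

lemmas skein_parallel =
  homfly[unfolded framed_homfly_def, THEN conjunct2, THEN conjunct1, rule_format, OF conjI]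

lemmas kink_right =
  homfly[unfolded framed_homfly_def, THEN conjunct2, THEN conjunct2, THEN conjunct2, THEN conjunct1, rule_format]

text \<open>Tangles that \<open>H\<close> cannot distinguish in any completion to a link diagram.
  Unlike equality of \<open>H\<close> on closed diagrams, this relation can be composed
  vertically.\<close>

definition heq :: "bool list \<Rightarrow> bool list \<Rightarrow> diagram \<Rightarrow> diagram \<Rightarrow> bool" where
  "heq s t X Y \<longleftrightarrow> tangle X s t \<and> tangle Y s t \<and>
     (\<forall>A B. tangle A [] s \<and> tangle B t [] \<longrightarrow> H (A @ X @ B) = H (A @ Y @ B))"

lemma heq_refl: "tangle X s t \<Longrightarrow> heq s t X X"
  by (simp add: heq_def)

lemma heq_sym: "heq s t X Y \<Longrightarrow> heq s t Y X"
  by (auto simp: heq_def)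

lemma heq_trans [trans]: "heq s t X Y \<Longrightarrow> heq s t Y Z \<Longrightarrow> heq s t X Z"
  by (auto simp: heq_def)

lemma heq_append:
  assumes "heq s t X Y" "heq t r Z W"
  shows "heq s r (X @ Z) (Y @ W)"
proof -
  have "H (A @ (X @ Z) @ B) = H (A @ (Y @ W) @ B)" if "tangle A [] s" "tangle B r []" for A B
  proof -
    have "H (A @ X @ (Z @ B)) = H (A @ Y @ (Z @ B))"
      using assms that unfolding heq_def by (blast intro: tangle_append)
    moreover have "H ((A @ Y) @ Z @ B) = H ((A @ Y) @ W @ B)"
      using assms that unfolding heq_def by (blast intro: tangle_append)
    ultimately show ?thesis by simp
  qed
  then show ?thesis
    using assms unfolding heq_def by (blast intro: tangle_append)
qed

lemma heqD: "heq [] [] X Y \<Longrightarrow> H X = H Y"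
  using tangle.Nil by (fastforce simp: heq_def)

lemma heq_move:
  assumes "local_move X Y" "tangle X s t" "tangle Y s t"
  shows "heq s t X Y"
proof -
  have "H (A @ X @ B) = H (A @ Y @ B)" if "tangle A [] s" "tangle B t []" for A B
  proof -
    have "link_diagram (A @ X @ B)" "link_diagram (A @ Y @ B)"
      unfolding link_diagram_def using assms that by (blast intro: tangle_append)+
    then show ?thesis
      by (rule isotopy[OF assms(1)])
  qed
  then show ?thesis using assms by (simp add: heq_def)
qed

text \<open>Every crossing of \<open>b\<close> lies entirely to the left of position
  \<open>j\<close>, so it is exchanged with the piece by a distant move. The orientations are
  required on both levels because the piece may change them.\<close>

lemma heq_slide:
  assumes "braid_word n b" "n \<le> j" "layer (j, Q) s t"
    and "n \<le> length s" "\<And>i. i < n \<Longrightarrow> s ! i" "n \<le> length t" "\<And>i. i < n \<Longrightarrow> t ! i"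
  shows "heq s t ((j, Q) # crossings b) (crossings b @ [(j, Q)])"
  using assms(1)
proof (induction b)
  case Nil
  then show ?case using assms(3) by (auto intro: heq_refl tangle_single)
next
  case (Cons c b)
  let ?i = "fst c - 1"
  have c: "braid_word n [c]" and b: "braid_word n b" and i: "1 \<le> fst c" "fst c < n"
    using Cons.prems by auto
  have tc: "tangle [(?i, Cross (snd c))] s s" "tangle [(?i, Cross (snd c))] t t"
    using tangle_crossings[OF c assms(4)] tangle_crossings[OF c assms(6)] assms(5,7) by simp_all
  have "local_move [(?i, Cross (snd c)), (j, Q)] [(j, Q), (?i, Cross (snd c))]"
    using i assms(2) by (intro local_move_cross_far) simp
  then have "heq s t [(?i, Cross (snd c)), (j, Q)] [(j, Q), (?i, Cross (snd c))]"
    using tc tangle_append[OF tc(1) tangle_single[OF assms(3)]] tangle.Cons[OF assms(3) tc(2)]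
    by (intro heq_move) auto
  from heq_append[OF heq_sym[OF this] heq_refl[OF tangle_crossings[OF b assms(6,7)]]]
  have "heq s t ((j, Q) # crossings (c # b)) ([(?i, Cross (snd c))] @ ((j, Q) # crossings b))"
    by simp
  also have "heq s t \<dots> ([(?i, Cross (snd c))] @ (crossings b @ [(j, Q)]))"
    by (rule heq_append[OF heq_refl[OF tc(1)] Cons.IH[OF b]])
  finally show ?case by simp
qed

text \<open>The crossing swings from the two left legs to the region between two adjacent cups, and
  from there to the two right legs. Each swing reverses the flag, so \<open>c\<close>
  returns.\<close>

lemma heq_nested_cups:
  assumes "length a = m"
  shows "heq (a @ b) (a @ [True, True, False, False] @ b)
    [(m, Cup True), (m + 1, Cup True), (m, Cross c)] [(m, Cup True), (m + 1, Cup True), (m + 2, Cross c)]"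
proof -
  let ?s0 = "a @ b" and ?s1 = "a @ [True, False] @ b" and ?s2 = "a @ [True, True, False, False] @ b"
    and ?s3 = "a @ [True, False, True, False] @ b"
  have l: "layer (m, Cup True) ?s0 ?s1" "layer (m + 1, Cup True) ?s1 ?s2" "layer (m, Cup True) ?s1 ?s3"
    "layer (m + 2, Cup True) ?s1 ?s3"
    using assms layer_cupI[of a m ?s0 b ?s1 True] layer_cupI[of "a @ [True]" "m + 1" ?s1 "False # b" ?s2 True]
      layer_cupI[of a m ?s1 "True # False # b" ?s3 True] layer_cupI[of "a @ [True, False]" "m + 2" ?s1 b ?s3 True]
    by simp_all
  have x: "layer (m, Cross c) ?s2 ?s2" "layer (m + 2, Cross c) ?s2 ?s2" "layer (m + 1, Cross (\<not> c)) ?s3 ?s2"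
    using assms layer_crossI[of a m ?s2 True True "False # False # b" ?s2]
      layer_crossI[of "a @ [True, True]" "m + 2" ?s2 False False b ?s2]
      layer_crossI[of "a @ [True]" "m + 1" ?s3 False True "False # b" ?s2]
    by simp_all
  note t = tangle.Cons[OF l(1)] tangle.Cons[OF l(2)] tangle.Cons[OF l(3)] tangle.Cons[OF l(4)]
    tangle.Cons[OF x(1)] tangle.Cons[OF x(2)] tangle.Cons[OF x(3)] tangle.Nil
  have *: "heq ?s0 ?s2 ([(m, Cup True)] @ Z) ([(m, Cup True)] @ W)" if "heq ?s1 ?s2 Z W" for Z W
    by (rule heq_append[OF heq_refl that]) (rule t(1)[OF t(8)])
  have "heq ?s1 ?s2 [(m + 1, Cup True), (m, Cross c)] [(m, Cup True), (m + 1, Cross (\<not> c))]"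
    using local_move.swing_cup[of m True "\<not> c"] by (intro heq_sym[OF heq_move] t) simp
  from *[OF this] have "heq ?s0 ?s2 [(m, Cup True), (m + 1, Cup True), (m, Cross c)]
      [(m, Cup True), (m, Cup True), (m + 1, Cross (\<not> c))]" by simp
  also have "heq ?s0 ?s2 \<dots> [(m, Cup True), (m + 2, Cup True), (m + 1, Cross (\<not> c))]"
  proof -
    \<comment> \<open>Between the swings the cups stand side by side; exchanging their heights puts
      the right one next to the crossing.\<close>
    have "heq ?s0 ?s3 [(m, Cup True), (m, Cup True)] [(m, Cup True), (m + 2, Cup True)]"
      using local_move.far[of m "Cup True" 0 "Cup True"] by (intro heq_sym[OF heq_move] t) simp
    from heq_append[OF this heq_refl[OF t(7)[OF t(8)]]] show ?thesis by simp
  qed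
  also have "heq ?s0 ?s2 \<dots> [(m, Cup True), (m + 1, Cup True), (m + 2, Cross c)]"
  proof -
    have "heq ?s1 ?s2 [(m + 2, Cup True), (m + 1, Cross (\<not> c))] [(m + 1, Cup True), (m + 2, Cross c)]"
      using local_move.swing_cup[of "m + 1" True c] by (intro heq_sym[OF heq_move] t) simp
    from *[OF this] show ?thesis by simp
  qed
  finally show ?thesis .
qed

lemma heq_nested_caps:
  assumes "length a = m"
  shows "heq (a @ [True, True, False, False] @ b) (a @ b)
    [(m, Cross c), (m + 1, Cap), (m, Cap)] [(m + 2, Cross c), (m + 1, Cap), (m, Cap)]"
proof -
  let ?s0 = "a @ b" and ?s1 = "a @ [True, False] @ b" and ?s2 = "a @ [True, True, False, False] @ b"
    and ?s3 = "a @ [True, False, True, False] @ b"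
  have l: "layer (m, Cap) ?s1 ?s0" "layer (m + 1, Cap) ?s2 ?s1" "layer (m, Cap) ?s3 ?s1"
    "layer (m + 2, Cap) ?s3 ?s1"
    using assms layer_capI[of a m ?s1 True b ?s0] layer_capI[of "a @ [True]" "m + 1" ?s2 True "False # b" ?s1]
      layer_capI[of a m ?s3 True "True # False # b" ?s1] layer_capI[of "a @ [True, False]" "m + 2" ?s3 True b ?s1]
    by simp_all
  have x: "layer (m, Cross c) ?s2 ?s2" "layer (m + 2, Cross c) ?s2 ?s2" "layer (m + 1, Cross (\<not> c)) ?s2 ?s3"
    using assms layer_crossI[of a m ?s2 True True "False # False # b" ?s2]
      layer_crossI[of "a @ [True, True]" "m + 2" ?s2 False False b ?s2]
      layer_crossI[of "a @ [True]" "m + 1" ?s2 True False "False # b" ?s3]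
    by simp_all
  note t = tangle.Cons[OF l(1)] tangle.Cons[OF l(2)] tangle.Cons[OF l(3)] tangle.Cons[OF l(4)]
    tangle.Cons[OF x(1)] tangle.Cons[OF x(2)] tangle.Cons[OF x(3)] tangle.Nil
  have *: "heq ?s2 ?s0 (Z @ [(m, Cap)]) (W @ [(m, Cap)])" if "heq ?s2 ?s1 Z W" for Z W
    by (rule heq_append[OF that heq_refl]) (rule t(1)[OF t(8)])
  have "heq ?s2 ?s1 [(m, Cross c), (m + 1, Cap)] [(m + 1, Cross (\<not> c)), (m, Cap)]"
    using local_move.swing_cap[of m "\<not> c"] by (intro heq_sym[OF heq_move] t) simp
  from *[OF this] have "heq ?s2 ?s0 [(m, Cross c), (m + 1, Cap), (m, Cap)]
      [(m + 1, Cross (\<not> c)), (m, Cap), (m, Cap)]" by simp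
  also have "heq ?s2 ?s0 \<dots> [(m + 1, Cross (\<not> c)), (m + 2, Cap), (m, Cap)]"
  proof -
    have "heq ?s3 ?s0 [(m, Cap), (m, Cap)] [(m + 2, Cap), (m, Cap)]"
      using local_move.far[of m Cap 0 Cap] by (intro heq_move t) simp
    from heq_append[OF heq_refl[OF t(7)[OF t(8)]] this] show ?thesis by simp
  qed
  also have "heq ?s2 ?s0 \<dots> [(m + 2, Cross c), (m + 1, Cap), (m, Cap)]"
  proof -
    have "heq ?s2 ?s1 [(m + 1, Cross (\<not> c)), (m + 2, Cap)] [(m + 2, Cross c), (m + 1, Cap)]"
      using local_move.swing_cap[of "m + 1" c] by (intro heq_sym[OF heq_move] t) simp
    from *[OF this] show ?thesis by simp
  qed
  finally show ?thesis .
qed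

lemma layer_cross_up_down:
  "Suc i < n \<or> n \<le> i \<and> Suc i < 2 * n \<Longrightarrow> layer (i, Cross c) (up_down n) (up_down n)"
  by (rule layer_cross_parallel) (auto simp: up_down_nth)

text \<open>The nested arcs join position \<open>i\<close> to \<open>2 * n - 1 - i\<close>, so the
  crossing reappears at \<open>2 * n - 2 - i\<close>. If it avoids the innermost cup, it is lowered
  below that cup, treated by induction and raised again; otherwise it involves the two innermost
  cups.\<close>

lemma heq_around_cups:
  "Suc i < n \<Longrightarrow> heq [] (up_down n) (cups n @ [(i, Cross c)]) (cups n @ [(2 * n - 2 - i, Cross c)])"
proof (induction n)
  case 0
  then show ?case by simp
next
  case (Suc n)
  show ?case
  proof (cases "Suc i < n")
    case True
    let ?j = "2 * n - 2 - i"
    have j: "n \<le> ?j" "Suc ?j < 2 * n" "2 * Suc n - 2 - i = ?j + 2" using True by simp_all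
    have "heq (up_down n) (up_down (Suc n)) ((n, Cup True) # crossings [(Suc i, c)]) (crossings [(Suc i, c)] @ [(n, Cup True)])"
      using True by (intro heq_slide layer_up_down) (auto simp: up_down_nth)
    from heq_append[OF heq_refl[OF tangle_cups] this]
    have "heq [] (up_down (Suc n)) (cups (Suc n) @ [(i, Cross c)]) ((cups n @ [(i, Cross c)]) @ [(n, Cup True)])"
      by (simp add: cups_Suc)
    also have "heq [] (up_down (Suc n)) \<dots> ((cups n @ [(?j, Cross c)]) @ [(n, Cup True)])"
      by (rule heq_append[OF Suc.IH[OF True] heq_refl[OF tangle_single[OF layer_up_down(1)]]])
    also have "heq [] (up_down (Suc n)) \<dots> (cups (Suc n) @ [(?j + 2, Cross c)])"
    proof -
      have "local_move [(n, Cup True), (?j + 2, Cross c)] [(?j, Cross c), (n, Cup True)]"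
        by (rule local_move_cup_far[OF j(1)])
      moreover have "tangle [(n, Cup True), (?j + 2, Cross c)] (up_down n) (up_down (Suc n))"
        "tangle [(?j, Cross c), (n, Cup True)] (up_down n) (up_down (Suc n))"
        using j by (auto intro!: tangle.Cons[OF layer_up_down(1)] tangle.Cons[OF layer_cross_up_down] tangle.Nil)
      ultimately have "heq (up_down n) (up_down (Suc n)) [(?j, Cross c), (n, Cup True)] [(n, Cup True), (?j + 2, Cross c)]"
        by (intro heq_sym[OF heq_move])
      from heq_append[OF heq_refl[OF tangle_cups] this] show ?thesis
        by (simp add: cups_Suc)
    qed
    finally show ?thesis using j by simp
  next
    case False
    then obtain m where n: "n = Suc m" "i = m"
      using Suc.prems by (cases n) auto
    have "up_down (Suc n) = replicate m True @ [True, True, False, False] @ replicate m False"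
      unfolding up_down_Suc n by (simp add: replicate_app_Cons_same)
    moreover have "2 * Suc n - 2 - i = m + 2" using n by simp
    moreover have "heq [] (replicate m True @ [True, True, False, False] @ replicate m False)
        (cups m @ [(m, Cup True), (Suc m, Cup True), (m, Cross c)])
        (cups m @ [(m, Cup True), (Suc m, Cup True), (m + 2, Cross c)])"
      using heq_append[OF heq_refl[OF tangle_cups[unfolded up_down_def]] heq_nested_cups] by simp
    ultimately show ?thesis by (simp only: n cups_Suc append_assoc append.simps)
  qed
qed

text \<open>The argument for cups turned upside down; the innermost cap is now the lowest
  one.\<close>

lemma heq_around_caps:
  "Suc i < n \<Longrightarrow> heq (up_down n) [] ([(i, Cross c)] @ caps n) ([(2 * n - 2 - i, Cross c)] @ caps n)"
proof (induction n)
  case 0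
  then show ?case by simp
next
  case (Suc n)
  show ?case
  proof (cases "Suc i < n")
    case True
    let ?j = "2 * n - 2 - i"
    have j: "n \<le> ?j" "Suc ?j < 2 * n" "2 * Suc n - 2 - i = ?j + 2" using True by simp_all
    have "heq (up_down (Suc n)) (up_down n) ((n, Cap) # crossings [(Suc i, c)]) (crossings [(Suc i, c)] @ [(n, Cap)])"
      using True by (intro heq_slide layer_up_down) (auto simp: up_down_nth)
    from heq_append[OF heq_sym[OF this] heq_refl[OF tangle_caps]]
    have "heq (up_down (Suc n)) [] ([(i, Cross c)] @ caps (Suc n)) ([(n, Cap)] @ ([(i, Cross c)] @ caps n))"
      by (simp add: caps_Suc)
    also have "heq (up_down (Suc n)) [] \<dots> ([(n, Cap)] @ ([(?j, Cross c)] @ caps n))"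
      by (rule heq_append[OF heq_refl[OF tangle_single[OF layer_up_down(2)]] Suc.IH[OF True]])
    also have "heq (up_down (Suc n)) [] \<dots> ([(?j + 2, Cross c)] @ caps (Suc n))"
    proof -
      have "local_move [(n, Cap), (?j, Cross c)] [(?j + 2, Cross c), (n, Cap)]"
        by (rule local_move_cap_far[OF j(1)])
      moreover have "tangle [(?j + 2, Cross c), (n, Cap)] (up_down (Suc n)) (up_down n)"
        "tangle [(n, Cap), (?j, Cross c)] (up_down (Suc n)) (up_down n)"
        using j by (auto intro!: tangle.Cons[OF layer_up_down(2)] tangle.Cons[OF layer_cross_up_down] tangle.Nil)
      ultimately have "heq (up_down (Suc n)) (up_down n) [(n, Cap), (?j, Cross c)] [(?j + 2, Cross c), (n, Cap)]"
        by (intro heq_move)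
      from heq_append[OF this heq_refl[OF tangle_caps]] show ?thesis
        by (simp add: caps_Suc)
    qed
    finally show ?thesis using j by simp
  next
    case False
    then obtain m where n: "n = Suc m" "i = m"
      using Suc.prems by (cases n) auto
    have "up_down (Suc n) = replicate m True @ [True, True, False, False] @ replicate m False"
      unfolding up_down_Suc n by (simp add: replicate_app_Cons_same)
    moreover have "2 * Suc n - 2 - i = m + 2" using n by simp
    moreover have "heq (replicate m True @ [True, True, False, False] @ replicate m False) []
        ([(m, Cross c), (Suc m, Cap), (m, Cap)] @ caps m)
        ([(m + 2, Cross c), (Suc m, Cap), (m, Cap)] @ caps m)"
      using heq_append[OF heq_nested_caps heq_refl[OF tangle_caps[unfolded up_down_def]]] by simp
    ultimately show ?thesis by (simp only: n caps_Suc append_assoc append.simps)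
  qed
qed

section \<open>Markov properties of the braid closure\<close>

lemma heq_closure:
  assumes "braid_word n A" "braid_word n B" "heq (up_down n) (up_down n) (crossings X) (crossings Y)"
  shows "H (braid_closure n (A @ X @ B)) = H (braid_closure n (A @ Y @ B))"
proof -
  have "tangle (cups n @ crossings A) [] (up_down n)" "tangle (crossings B @ caps n) (up_down n) []"
    using assms by (auto intro: tangle_append tangle_cups tangle_caps tangle_crossings_up_down)
  then have "H ((cups n @ crossings A) @ crossings X @ crossings B @ caps n)
      = H ((cups n @ crossings A) @ crossings Y @ crossings B @ caps n)"
    using assms(3) unfolding heq_def by blast
  then show ?thesis by (simp add: braid_closure_eq)
qed

text \<open>The first crossing goes through the cups onto the closing strands, slides up past the
  rest of the braid, and returns through the caps.\<close>

lemma closure_rotate: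
  assumes "braid_word n (c # b)"
  shows "H (braid_closure n (c # b)) = H (braid_closure n (b @ [c]))"
proof -
  let ?i = "fst c - 1" and ?j = "2 * n - 2 - (fst c - 1)"
  have c: "1 \<le> fst c" "fst c < n" and b: "braid_word n b" using assms by auto
  have i: "Suc ?i < n" and j: "n \<le> ?j" "Suc ?j < 2 * n" using c by auto
  let ?c = "Cross (snd c)"
  have tb: "tangle (crossings b) (up_down n) (up_down n)"
    using b by (rule tangle_crossings_up_down) simp
  have "heq [] [] ((cups n @ [(?i, ?c)]) @ (crossings b @ caps n)) ((cups n @ [(?j, ?c)]) @ (crossings b @ caps n))"
    by (rule heq_append[OF heq_around_cups[OF i] heq_refl[OF tangle_append[OF tb tangle_caps]]])
  also have "heq [] [] \<dots> (cups n @ ((crossings b @ [(?j, ?c)]) @ caps n))"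
  proof -
    have "heq (up_down n) (up_down n) ((?j, ?c) # crossings b) (crossings b @ [(?j, ?c)])"
      using b j by (intro heq_slide layer_cross_up_down) (auto simp: up_down_nth)
    from heq_append[OF heq_refl[OF tangle_cups] heq_append[OF this heq_refl[OF tangle_caps]]]
    show ?thesis by simp
  qed
  also have "heq [] [] \<dots> ((cups n @ crossings b) @ ([(?i, ?c)] @ caps n))"
    using heq_append[OF heq_refl[OF tangle_append[OF tangle_cups tb]] heq_sym[OF heq_around_caps[OF i]]]
    by simp
  finally show ?thesis
    using heqD by (simp add: braid_closure_eq)
qed

lemma closure_cyclic: "braid_word n (a @ b) \<Longrightarrow> H (braid_closure n (a @ b)) = H (braid_closure n (b @ a))"
proof (induction a arbitrary: b)
  case Nil
  then show ?case by simp
next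
  case (Cons c a)
  have "H (braid_closure n ((c # a) @ b)) = H (braid_closure n (a @ (b @ [c])))"
    using closure_rotate[of n c "a @ b"] Cons.prems by simp
  also have "\<dots> = H (braid_closure n ((b @ [c]) @ a))"
    by (rule Cons.IH) (use Cons.prems in simp)
  finally show ?case by simp
qed

lemma closure_skein:
  assumes "braid_word n A" "braid_word n B" "1 \<le> i" "i < n"
  shows "H (braid_closure n (A @ [(i, True)] @ B)) - H (braid_closure n (A @ [(i, False)] @ B))
    = (qe (- 1) - qe 1) * H (braid_closure n (A @ B))"
proof -
  \<comment> \<open>The strands to the left and right of the crossing, which bring the level into
    the shape of the skein rule.\<close>
  let ?s = "take (i - 1) (up_down n)" and ?t = "drop (i - 1 + 2) (up_down n)"
  have "up_down n ! (i - 1)" "up_down n ! Suc (i - 1)"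
    using assms by (auto simp: up_down_nth)
  then have s: "?s @ [True, True] @ ?t = up_down n" "length ?s = i - 1"
    using split_two[of "i - 1" "up_down n"] assms by auto
  have "tangle (cups n @ crossings A) [] (up_down n)" "tangle (crossings B @ caps n) (up_down n) []"
    using assms by (auto intro: tangle_append tangle_cups tangle_caps tangle_crossings_up_down)
  then have "tangle (cups n @ crossings A) [] (?s @ [True, True] @ ?t)"
    "tangle (crossings B @ caps n) (?s @ [True, True] @ ?t) []"
    unfolding s(1) .
  then have "H ((cups n @ crossings A) @ [(length ?s, Cross True)] @ (crossings B @ caps n))
      - H ((cups n @ crossings A) @ [(length ?s, Cross False)] @ (crossings B @ caps n))
      = (qe (- 1) - qe 1) * H ((cups n @ crossings A) @ (crossings B @ caps n))"
    by (rule skein_parallel)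
  then show ?thesis
    unfolding s(2) by (simp add: braid_closure_eq)
qed

text \<open>As \<open>x\<close> and \<open>y\<close> avoid the last strand, its cup is raised above
  \<open>x\<close> and its cap lowered below \<open>y\<close>; what is left around the crossing is a
  kink to the right of strand \<open>n\<close>.\<close>

lemma closure_kink:
  assumes "1 \<le> n" "braid_word n x" "braid_word n y"
  shows "H (braid_closure (Suc n) (x @ [(n, c)] @ y))
    = (if c then qe (- \<beta>) else qe \<beta>) * H (braid_closure n (x @ y))"
proof -
  let ?A = "cups n @ crossings x" and ?B = "crossings y @ caps n"
  let ?K = "[(n, Cup True), (n - 1, Cross c), (n, Cap)]"
  have x: "heq (up_down n) (up_down (Suc n)) ((n, Cup True) # crossings x) (crossings x @ [(n, Cup True)])"
    and y: "heq (up_down (Suc n)) (up_down n) ((n, Cap) # crossings y) (crossings y @ [(n, Cap)])"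
    using assms by (auto intro!: heq_slide layer_up_down simp: up_down_nth)
  have cross: "tangle [(n - 1, Cross c)] (up_down (Suc n)) (up_down (Suc n))"
    using assms by (intro tangle_single layer_cross_up_down) auto
  have "heq [] [] (braid_closure (Suc n) (x @ [(n, c)] @ y)) (?A @ ?K @ ?B)"
    using heq_append[OF heq_append[OF heq_append[OF heq_append[OF heq_refl[OF tangle_cups] x]
      heq_refl[OF cross]] heq_sym[OF y]] heq_refl[OF tangle_caps]]
    by (simp add: braid_closure_eq cups_Suc caps_Suc)
  then have "tangle (?A @ ?K @ ?B) [] []"
    and "H (braid_closure (Suc n) (x @ [(n, c)] @ y)) = H (?A @ ?K @ ?B)"
    by (auto simp: heq_def intro: heqD)
  then have "H (braid_closure (Suc n) (x @ [(n, c)] @ y))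
      = (if c then qe (- \<beta>) else qe \<beta>) * H (?A @ ?B)"
    using kink_right[of ?A "n - 1" True c ?B] assms(1) by (simp add: link_diagram_def)
  then show ?thesis by (simp add: braid_closure_eq)
qed

text \<open>In the skein relation for a crossing of the new strand with strand \<open>n\<close>,
  both signs are kinks, with factors \<open>qe (- \<beta>)\<close> and \<open>qe \<beta>\<close>,
  and the smoothing is the closure in question.\<close>

lemma closure_add_strand:
  assumes "qe 1 \<noteq> qe (- 1)" "1 \<le> n" "braid_word n x"
  shows "H (braid_closure (Suc n) x) = qint qe \<beta> * H (braid_closure n x)"
proof -
  have "(qe (- 1) - qe 1) * H (braid_closure (Suc n) x) = (qe (- \<beta>) - qe \<beta>) * H (braid_closure n x)"
    using closure_skein[of "Suc n" x "[]" n] closure_kink[OF assms(2,3), of "[]"] assms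
      braid_word_mono[of n x "Suc n"]
    by (simp add: left_diff_distrib)
  then have "(qe 1 - qe (- 1)) * H (braid_closure (Suc n) x) = (qe \<beta> - qe (- \<beta>)) * H (braid_closure n x)"
    by (simp add: algebra_simps)
  also have "qe \<beta> - qe (- \<beta>) = (qe 1 - qe (- 1)) * qint qe \<beta>"
    using assms(1) by (simp add: qint_def)
  finally show ?thesis using assms(1) by simp
qed

lemma closure_unknot: "H (braid_closure 1 []) = qint qe \<beta>"
  using homfly by (simp add: braid_closure_def framed_homfly_def)

lemma heq_crossings_move:
  assumes "local_move (crossings X) (crossings Y)" "braid_word n X" "braid_word n Y"
  shows "heq (up_down n) (up_down n) (crossings X) (crossings Y)"
  using assms by (intro heq_move tangle_crossings_up_down[of n]) auto

lemma closure_far: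
  assumes "braid_word n A" "braid_word n B" "1 \<le> i" "1 \<le> j" "i < n" "j < n" "i + 1 < j \<or> j + 1 < i"
  shows "H (braid_closure n (A @ [(i, p), (j, r)] @ B)) = H (braid_closure n (A @ [(j, r), (i, p)] @ B))"
proof -
  have *: "heq (up_down n) (up_down n) (crossings [(i, p), (j, r)]) (crossings [(j, r), (i, p)])"
    if "1 \<le> i" "i + 1 < j" "j < n" for i j p r
    using that by (intro heq_crossings_move) (auto intro: local_move_cross_far)
  then have "heq (up_down n) (up_down n) (crossings [(i, p), (j, r)]) (crossings [(j, r), (i, p)])"
    using assms(3-7) by (auto intro: heq_sym)
  then show ?thesis by (rule heq_closure[OF assms(1,2)])
qed

lemma closure_braid:
  assumes "braid_word n A" "braid_word n B" "1 \<le> i" "i + 1 < n"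
  shows "H (braid_closure n (A @ [(i, True), (i + 1, True), (i, True)] @ B))
    = H (braid_closure n (A @ [(i + 1, True), (i, True), (i + 1, True)] @ B))"
  using local_move.reidemeister3[of "i - 1" True] assms
  by (intro heq_closure heq_crossings_move) auto

lemma closure_cancel:
  assumes "braid_word n A" "braid_word n B" "1 \<le> i" "i < n"
  shows "H (braid_closure n (A @ [(i, p), (i, \<not> p)] @ B)) = H (braid_closure n (A @ B))"
  using heq_closure[OF assms(1,2) heq_crossings_move[of "[(i, p), (i, \<not> p)]" "[]"]]
    local_move.reidemeister2[of "i - 1" p] assms
  by simp

lemma braid_word_inv: "braid_word n (inv_braid c) \<longleftrightarrow> braid_word n c"
  by (auto simp: braid_word_def inv_braid_def)

text \<open>The last letter of \<open>inv_braid c\<close> is inverse to the first letter of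
  \<open>c\<close>, so the cancellation proceeds from the middle outwards.\<close>

lemma closure_cancel_inv:
  "braid_word n b \<Longrightarrow> braid_word n c \<Longrightarrow> H (braid_closure n (b @ inv_braid c @ c)) = H (braid_closure n b)"
proof (induction c)
  case Nil
  then show ?case by (simp add: inv_braid_def)
next
  case (Cons x c)
  have x: "inv_braid (x # c) = inv_braid c @ [(fst x, \<not> snd x)]"
    by (simp add: inv_braid_def split: prod.splits)
  have "H (braid_closure n (b @ inv_braid (x # c) @ x # c))
      = H (braid_closure n ((b @ inv_braid c) @ [(fst x, \<not> snd x), (fst x, \<not> \<not> snd x)] @ c))"
    by (simp add: x)
  also have "\<dots> = H (braid_closure n ((b @ inv_braid c) @ c))"
    using Cons.prems by (intro closure_cancel) (auto simp: braid_word_inv)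
  finally show ?case using Cons by simp
qed

lemma closure_conjugate:
  assumes "braid_word n b" "braid_word n c"
  shows "H (braid_closure n (c @ b @ inv_braid c)) = H (braid_closure n b)"
  using closure_cyclic[of n c "b @ inv_braid c"] closure_cancel_inv[OF assms] assms
  by (simp add: braid_word_inv)

end


section \<open>Comparison of the two traces\<close>

section \<open>The partial closure as a Markov trace\<close>

context partially_closed
begin

lemma partial_trace_mid_cong:
  assumes "1 \<le> n" "n \<le> k" "braid_word n A" "braid_word n B"
    and "braid_elt qe X \<approx>\<^bsub>strand_weight n\<^esub> braid_elt qe Y"
  shows "partial_trace n (A @ X @ B) \<approx>\<^bsub>strand_weight 1\<^esub> partial_trace n (A @ Y @ B)"
proof (rule partial_trace_cong[OF assms(1,2)])
  have "braid_elt qe B * braid_elt qe X * braid_elt qe A \<approx>\<^bsub>strand_weight n\<^esub> braid_elt qe B * braid_elt qe Y * braid_elt qe A"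
    using assms by (intro eqv_mult_mid[OF assms(5)] hom_rep_braid_word[of n] homog_braid_word[of n])
  then show "braid_elt qe (A @ X @ B) \<approx>\<^bsub>strand_weight n\<^esub> braid_elt qe (A @ Y @ B)"
    by (simp add: braid_elt_append)
qed

text \<open>An identity in the free algebra itself: crossings of both signs share the term
  \<open>EE i * FF i\<close> and differ by a scalar.\<close>

lemma partial_trace_skein:
  "partial_trace n (A @ [(i, True)] @ B) - partial_trace n (A @ [(i, False)] @ B) = scal (qe (- 1) - qe 1) * partial_trace n (A @ B)"
proof -
  have "L * (y * crossing qe (i, True) * x) * R - L * (y * crossing qe (i, False) * x) * R
      = scal (qe (- 1) - qe 1) * (L * (y * x) * R)" for L R x y :: "'f free_alg"
  proof -
    have "L * (y * crossing qe (i, True) * x) * R - L * (y * crossing qe (i, False) * x) * R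
        = L * y * (crossing qe (i, True) - crossing qe (i, False)) * x * R"
      by (simp add: algebra_simps)
    also have "crossing qe (i, True) - crossing qe (i, False) = scal (qe (- 1) - qe 1)"
      by (simp add: crossing_eq flip: scal_diff)
    finally show ?thesis
      by (simp add: scal_central mult.assoc)
  qed
  then show ?thesis
    by (simp only: partial_trace_def braid_elt_append braid_elt_single)
qed

lemma strand_weight_1: "1 \<le> i \<Longrightarrow> i \<le> n \<Longrightarrow> strand_weight n i = 1"
  by (simp add: strand_weight_def)

text \<open>On one strand only the empty word exists, and the unknot value makes the quotient 1. In
  the step, the words on which both sides agree form a skein-closed set; the Markov properties put
  the generating words of \<open>skein_closed_generates\<close> into it.\<close>

theorem partial_trace_eqv_homfly:
  assumes "framed_homfly qe \<beta> H" "qint qe \<beta> \<noteq> 0" "1 \<le> n" "n \<le> k" "braid_word n b"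
  shows "partial_trace n b \<approx>\<^bsub>strand_weight 1\<^esub> scal (H (braid_closure n b) / qint qe \<beta>)"
  using assms(3-5)
proof (induction n arbitrary: b rule: dec_induct)
  interpret framed_invariant qe \<beta> H by unfold_locales fact
  case base
  then have "b = []" by (cases b) auto
  then show ?case using assms(2) by (simp only: partial_trace_1 closure_unknot) simp
next
  interpret framed_invariant qe \<beta> H by unfold_locales fact
  case (step n)
  define h where "h b = H (braid_closure (Suc n) b) / qint qe \<beta>" for b
  define G where "G = {b. partial_trace (Suc n) b \<approx>\<^bsub>strand_weight 1\<^esub> scal (h b)}"
  have n: "1 \<le> Suc n" "Suc n \<le> k" "n < k" using step by auto
  \<comment> \<open>Covers the rules that preserve both values: distant exchange, the braid relation
    and insertion of a cancelling pair.\<close>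
  have move: "A @ Y @ B \<in> G"
    if "A @ X @ B \<in> G" "braid_word (Suc n) A" "braid_word (Suc n) B"
      "braid_elt qe X \<approx>\<^bsub>strand_weight (Suc n)\<^esub> braid_elt qe Y"
      "H (braid_closure (Suc n) (A @ X @ B)) = H (braid_closure (Suc n) (A @ Y @ B))" for A B X Y
    using eqv_trans[OF eqv_sym[OF partial_trace_mid_cong[OF n(1,2) that(2,3,4)]]] that(1,5)
    by (simp add: G_def h_def)
  have "skein_closed (Suc n) G"
    unfolding skein_closed_def
  proof (intro allI impI conjI; elim conjE)
    fix A B assume A: "braid_word (Suc n) A" and B: "braid_word (Suc n) B"
    show "A @ [(j, r), (i, p)] @ B \<in> G"
      if "1 \<le> i" "1 \<le> j" "i < Suc n" "j < Suc n" "i + 1 < j \<or> j + 1 < i" "A @ [(i, p), (j, r)] @ B \<in> G" for i j p r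
    proof (rule move[OF that(6) A B _ closure_far[OF A B that(1-5)]])
      have "commute (crossing qe (j, r)) (crossing qe (i, p))"
        using that n crossing_far[of i j p r] crossing_far[of j i r p] by (auto intro: commute_sym)
      then show "braid_elt qe [(i, p), (j, r)] \<approx>\<^bsub>strand_weight (Suc n)\<^esub> braid_elt qe [(j, r), (i, p)]"
        by (simp add: braid_elt_def commuteD)
    qed
    show "A @ [(i + 1, True), (i, True), (i + 1, True)] @ B \<in> G"
      if "1 \<le> i" "i + 1 < Suc n" "A @ [(i, True), (i + 1, True), (i, True)] @ B \<in> G" for i
      using crossing_braid[of i "strand_weight (Suc n)"] that n
      by (intro move[OF that(3) A B _ closure_braid[OF A B that(1,2)]])
         (simp add: braid_elt_def strand_weight_1 mult.assoc)
    show "A @ [(i, True), (i, False)] @ B \<in> G" if i: "1 \<le> i" "i < Suc n" and "A @ B \<in> G" for i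
    proof -
      have "crossing qe (i, False) * crossing qe (i, True) \<approx>\<^bsub>strand_weight (Suc n)\<^esub> 1"
        using crossing_cancel[of i "strand_weight (Suc n)" False] i n by (simp add: strand_weight_1)
      then have "braid_elt qe [] \<approx>\<^bsub>strand_weight (Suc n)\<^esub> braid_elt qe [(i, True), (i, False)]"
        by (auto simp: braid_elt_def intro: eqv_sym)
      with move[of A "[]" B "[(i, True), (i, False)]"] closure_cancel[OF A B i, of True] \<open>A @ B \<in> G\<close> A B
      show ?thesis by simp
    qed
    show "A @ [(i, \<not> p)] @ B \<in> G"
      if i: "1 \<le> i" "i < Suc n" and AB: "A @ B \<in> G" and AiB: "A @ [(i, p)] @ B \<in> G" for i p
    proof -
      let ?c = "if p then qe 1 - qe (- 1) else qe (- 1) - qe 1"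
      have "partial_trace (Suc n) (A @ [(i, \<not> p)] @ B) = partial_trace (Suc n) (A @ [(i, p)] @ B) + scal ?c * partial_trace (Suc n) (A @ B)"
        using partial_trace_skein[of "Suc n" A i B] by (auto simp: algebra_simps simp flip: scal_diff)
      also have "\<dots> \<approx>\<^bsub>strand_weight 1\<^esub> scal (h (A @ [(i, p)] @ B)) + scal ?c * scal (h (A @ B))"
        using AB AiB by (intro eqv_add eqv_scal) (auto simp: G_def)
      also have "\<dots> = scal (h (A @ [(i, p)] @ B) + ?c * h (A @ B))"
        by (simp add: scal_add scal_mult)
      also have "h (A @ [(i, p)] @ B) + ?c * h (A @ B) = h (A @ [(i, \<not> p)] @ B)"
        using closure_skein[OF A B i] by (auto simp: h_def algebra_simps simp flip: add_divide_distrib diff_divide_distrib)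
      finally show ?thesis by (simp add: G_def)
    qed
  qed
  moreover have "x \<in> G" if x: "braid_word n x" for x
  proof -
    have "partial_trace (Suc n) x \<approx>\<^bsub>strand_weight 1\<^esub> scal (qint qe \<beta>) * partial_trace n x"
      using partial_trace_add_strand step n x by simp
    also have "\<dots> \<approx>\<^bsub>strand_weight 1\<^esub> scal (qint qe \<beta>) * scal (H (braid_closure n x) / qint qe \<beta>)"
      using step n x by (intro eqv_scal) auto
    also have "\<dots> = scal (h x)"
      using closure_add_strand[OF q_neq _ x] step by (simp add: scal_mult h_def)
    finally show ?thesis by (simp add: G_def)
  qed
  moreover have "x @ [(n, True)] @ y \<in> G" if "1 \<le> n" and x: "braid_word n x" and y: "braid_word n y" for x y
  proof -
    have "partial_trace (Suc n) (x @ [(n, True)] @ y) \<approx>\<^bsub>strand_weight 1\<^esub> scal (qe (- \<beta>)) * partial_trace n (x @ y)"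
      using partial_trace_kink step n x y by simp
    also have "\<dots> \<approx>\<^bsub>strand_weight 1\<^esub> scal (qe (- \<beta>)) * scal (H (braid_closure n (x @ y)) / qint qe \<beta>)"
      using step n x y by (intro eqv_scal) auto
    also have "\<dots> = scal (h (x @ [(n, True)] @ y))"
      using closure_kink[OF _ x y, of True] step by (simp add: scal_mult h_def)
    finally show ?thesis by (simp add: G_def)
  qed
  ultimately have "b \<in> G"
    using step.prems(2) by (rule skein_closed_generates)
  then show ?case by (simp add: G_def h_def)
qed

text \<open>Words list crossings from the bottom while products are read from right to left, so the
  conjugated product belongs to the word starting with \<open>pass_under j\<close>.\<close>

lemma partial_closure_eq:
  "partial_closure qe k j b = prod_list (map FF (rev [1..<j]))
     * partial_trace k (pass_under j @ b @ inv_braid (pass_under j)) * prod_list (map EE [1..<j])"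
  by (simp add: partial_closure_def partial_trace_def braid_elt_append mult.assoc)

text \<open>Conjugation does not change \<open>H\<close>, so the middle part is the scalar found for
  the first strand open. The outer chains carry the 1 from position \<open>j\<close> to position 1
  and back, and collapse to the identity by \<open>eqv_FE_chain\<close>.\<close>

theorem partial_closure_homfly:
  assumes "framed_homfly qe \<beta> H" "qint qe \<beta> \<noteq> 0" "braid_word k b" "1 \<le> j" "j \<le> k" "l = k - 1"
  shows "mor qe \<beta> k l (mu \<beta> k j) (mu \<beta> k j) (partial_closure qe k j b) \<in> Hom qe \<beta> k l (mu \<beta> k j) (mu \<beta> k j)"
    and "mor qe \<beta> k l (mu \<beta> k j) (mu \<beta> k j) (partial_closure qe k j b)
      = mor qe \<beta> k l (mu \<beta> k j) (mu \<beta> k j) (scal (H (braid_closure k b) / qint qe \<beta>))"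
proof -
  interpret framed_invariant qe \<beta> H by unfold_locales fact
  let ?c = "pass_under j"
  let ?b = "?c @ b @ inv_braid ?c"
  let ?\<nu> = "mu \<beta> k j" and ?h = "H (braid_closure k b) / qint qe \<beta>"
  let ?F = "prod_list (map FF (rev [1..<j])) :: 'f free_alg" and ?E = "prod_list (map EE [1..<j]) :: 'f free_alg"
  have c: "braid_word k ?c"
    using assms by (auto simp: pass_under_def braid_word_def)
  then have b: "braid_word k ?b"
    using assms by (simp add: braid_word_inv)
  have "transfer 1 j ?\<nu> = strand_weight 1"
    unfolding transfer_def mu_def strand_weight_def using assms by (auto simp: fun_eq_iff)
  then have E: "?E \<in> hom_rep k l ?\<nu> (strand_weight 1)"
    using assms by (intro hom_rep_EE_chain) auto
  have "transfer j 1 (strand_weight 1) = ?\<nu>"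
    unfolding transfer_def mu_def strand_weight_def using assms by (auto simp: fun_eq_iff)
  then have F: "?F \<in> hom_rep k l (strand_weight 1) ?\<nu>" "homog ?F"
    using assms(4,5) by (auto intro!: hom_rep_FF_chain_rev homog_FF_list)
  have "partial_trace k ?b \<in> hom_rep k l (strand_weight 1) (strand_weight 1)"
    using hom_rep_closers[of k] hom_rep_braid_word[OF b] assms(4,5)
    unfolding partial_trace_def by (auto intro: hom_rep_mult)
  then have rep: "partial_closure qe k j b \<in> hom_rep k l ?\<nu> ?\<nu>"
    unfolding partial_closure_eq using E F(1) by (auto intro: hom_rep_mult)
  have "partial_trace k ?b \<approx>\<^bsub>strand_weight 1\<^esub> scal ?h"
    using partial_trace_eqv_homfly[OF assms(1,2) _ _ b] closure_conjugate[OF assms(3) c] assms by simp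
  then have "partial_closure qe k j b \<approx>\<^bsub>?\<nu>\<^esub> ?F * scal ?h * ?E"
    unfolding partial_closure_eq by (rule eqv_mult_mid[OF _ E F(2)])
  also have "\<dots> = scal ?h * (?F * ?E)"
    by (simp add: scal_central mult.assoc)
  also have "\<dots> \<approx>\<^bsub>?\<nu>\<^esub> scal ?h * 1"
    using assms by (intro eqv_scal eqv_FE_chain) (auto simp: mu_def)
  finally have "partial_closure qe k j b \<approx>\<^bsub>?\<nu>\<^esub> scal ?h" by simp
  from mor_eqI[OF rep hom_rep_scal this]
  show "mor qe \<beta> k l ?\<nu> ?\<nu> (partial_closure qe k j b) \<in> Hom qe \<beta> k l ?\<nu> ?\<nu>"
    and "mor qe \<beta> k l ?\<nu> ?\<nu> (partial_closure qe k j b) = mor qe \<beta> k l ?\<nu> ?\<nu> (scal ?h)"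
    by auto
qed

end


section \<open>Verification of the assumptions for generic and integer parameters\<close>

section \<open>The two exponentials\<close>

lemma Fract_power: "Fract (a :: 'a::idom) 1 ^ n = Fract (a ^ n) 1"
  by (induction n) (simp_all add: One_fract_def)

text \<open>A power equal to 1 in the fraction field is already 1 among the polynomials, where its
  degree would be \<open>n\<close> times a positive number.\<close>

lemma Fract_X_power_neq_1:
  assumes "0 < n" "0 < degree (p :: 'a::idom poly)"
  shows "Fract p 1 ^ n \<noteq> 1"
proof
  have "p \<noteq> 0" using assms(2) by auto
  assume "Fract p 1 ^ n = 1"
  then have "p ^ n = 1"
    by (simp add: Fract_power One_fract_def eq_fract)
  then have "n * degree p = 0"
    using \<open>p \<noteq> 0\<close> degree_power_eq[of p n] by simp
  then show False using assms by simp
qed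

lemma neq_inverse: "x ^ 2 \<noteq> 1 \<Longrightarrow> x \<noteq> 0 \<Longrightarrow> x \<noteq> inverse (x :: 'a::field)"
  by (metis power2_eq_square right_inverse)

lemma Fract_nonzero: "p \<noteq> 0 \<Longrightarrow> Fract (p :: 'a::idom) 1 \<noteq> 0"
  by (simp add: Zero_fract_def eq_fract)

lemma neg_one_notin_Nats: "(- 1 :: 'a::ring_char_0) \<notin> \<nat>"
proof
  assume "(- 1 :: 'a) \<in> \<nat>"
  then obtain n where "- 1 = (of_nat n :: 'a)" by (elim Nats_cases)
  then have "of_nat (Suc n) = (0 :: 'a)"
    by (metis add.commute add.right_inverse of_nat_Suc)
  then show False by (simp del: of_nat_Suc)
qed

lemma partially_closed_gen:
  shows "partially_closed qexp_gen k (k - 1)" and "qint qexp_gen beta_gen \<noteq> 0"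
proof -
  let ?q = "Fract [:[:0, 1:]:] 1 :: complex poly poly fract" and ?b = "Fract [:0, 1:] 1 :: complex poly poly fract"
  have nz: "?q \<noteq> 0" "?b \<noteq> 0" by (simp_all add: Fract_nonzero)
  \<comment> \<open>\<open>q\<close> is constant in the outer variable, so the degree argument does
    not see it; its square is compared with 1 in the inner polynomial ring.\<close>
  have "?q ^ 2 = Fract [:[:0, 1:] ^ 2:] 1"
    by (simp add: Fract_power power2_eq_square)
  moreover have "[:0, 1:] ^ 2 \<noteq> (1 :: complex poly)"
    by (simp add: power2_eq_square one_pCons)
  ultimately have q2: "?q ^ 2 \<noteq> 1"
    by (simp add: One_fract_def eq_fract one_pCons)
  have b2: "?b ^ 2 \<noteq> 1" by (rule Fract_X_power_neq_1) simp_all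
  have q: "qexp_gen 1 \<noteq> qexp_gen (- 1)"
    using neq_inverse[OF q2 nz(1)] by (simp add: qexp_gen_def power_int_minus)
  show "partially_closed qexp_gen k (k - 1)"
  proof
    show "qexp_gen 0 = 1" by (simp add: qexp_gen_def)
    show "qexp_gen (x + y) = qexp_gen x * qexp_gen y" for x y
      using nz by (simp add: qexp_gen_def power_int_add)
    show "(- 1 :: int poly) \<notin> \<nat>" by (rule neg_one_notin_Nats)
    show "k \<le> Suc (k - 1)" by simp
  qed (rule q)
  show "qint qexp_gen beta_gen \<noteq> 0"
  proof -
    have "qexp_gen beta_gen \<noteq> qexp_gen (- beta_gen)"
      using neq_inverse[OF b2 nz(2)] by (simp add: qexp_gen_def beta_gen_def power_int_minus)
    with q show ?thesis by (simp add: qint_def)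
  qed
qed

lemma partially_closed_int:
  assumes "2 \<le> m"
  shows "partially_closed qexp_int k (k - 1)" and "qint qexp_int m \<noteq> 0"
proof -
  let ?q = "Fract [:0, 1:] 1 :: complex poly fract"
  have nz: "?q \<noteq> 0" by (simp add: Fract_nonzero)
  \<comment> \<open>Equality would make the square of \<open>q^n\<close> equal to 1, against the
    degree of the variable. The cases \<open>n = 1\<close> and \<open>n = m\<close> are
    used.\<close>
  have *: "qexp_int n \<noteq> qexp_int (- n)" if "0 < n" for n
  proof -
    have "(?q ^ nat n) ^ 2 \<noteq> 1"
      unfolding power_mult[symmetric] using that by (intro Fract_X_power_neq_1) simp_all
    moreover have "qexp_int n = ?q ^ nat n" "qexp_int (- n) = inverse (qexp_int n)"
      using that by (simp add: qexp_int_def power_int_def, simp only: qexp_int_def power_int_minus)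
    ultimately show ?thesis
      using neq_inverse[of "?q ^ nat n"] nz by simp
  qed
  show "partially_closed qexp_int k (k - 1)"
  proof
    show "qexp_int 0 = 1" by (simp add: qexp_int_def)
    show "qexp_int (x + y) = qexp_int x * qexp_int y" for x y
      using nz by (simp add: qexp_int_def power_int_add)
    show "(- 1 :: int) \<notin> \<nat>" by (rule neg_one_notin_Nats)
    show "qexp_int 1 \<noteq> qexp_int (- 1)" by (rule *) simp
    show "k \<le> Suc (k - 1)" by simp
  qed
  show "qint qexp_int m \<noteq> 0"
    using *[of m] *[of 1] assms by (simp add: qint_def)
qed

theorem proposition4p6:
  fixes k j :: nat and b :: braid
  assumes "k \<ge> 1" and "braid_word k b" and "1 \<le> j" and "j \<le> k"
  shows "(\<forall>H. framed_homfly qexp_gen beta_gen H \<longrightarrow>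
            mor qexp_gen beta_gen k (k - 1) (mu beta_gen k j) (mu beta_gen k j)
                (partial_closure qexp_gen k j b)
              \<in> Hom qexp_gen beta_gen k (k - 1) (mu beta_gen k j) (mu beta_gen k j) \<and>
            mor qexp_gen beta_gen k (k - 1) (mu beta_gen k j) (mu beta_gen k j)
                (partial_closure qexp_gen k j b)
            = mor qexp_gen beta_gen k (k - 1) (mu beta_gen k j) (mu beta_gen k j)
                (scal (H (braid_closure k b) / qint qexp_gen beta_gen)))
       \<and> (\<forall>m H. 2 \<le> m \<and> framed_homfly qexp_int m H \<longrightarrow>
            mor qexp_int m k (k - 1) (mu m k j) (mu m k j) (partial_closure qexp_int k j b)
              \<in> Hom qexp_int m k (k - 1) (mu m k j) (mu m k j) \<and>
            mor qexp_int m k (k - 1) (mu m k j) (mu m k j) (partial_closure qexp_int k j b)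
            = mor qexp_int m k (k - 1) (mu m k j) (mu m k j)
                (scal (H (braid_closure k b) / qint qexp_int m)))"
  using partially_closed.partial_closure_homfly[OF partially_closed_gen(1) _ partially_closed_gen(2) assms(2-4) refl]
    partially_closed.partial_closure_homfly[OF partially_closed_int(1) _ partially_closed_int(2) assms(2-4) refl]
  by blast

end
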